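(* Suppose there exists a demi-bits generator $\{G_n:\{0,1\}^n\to\{0,1\}^{10n}\}_{n\in\mathbb{N}}$ (secure against $\mathbf{NP}/\mathrm{poly}$). Then the range avoidance problem $\textsc{Avoid}$ is not in $\mathbf{SearchNP}$.
   Context: Range avoidance ($\textsc{Avoid}$): given a Boolean circuit $C:\{0,1\}^a\to\{0,1\}^b$ with $b>a$, output some $y\in\{0,1\}^b\setminus\mathrm{Range}(C)$ (such $y$ always exists). A nondeterministic polynomial-time algorithm (Turing machine) $M$ solves a search problem if for every input $x$: if $x$ has a solution then $M(x)$ has at least one accepting computation path and every accepting path outputs a valid solution; if $x$ has no solution then $M(x)$ has no accepting path. $\mathbf{SearchNP}$ is the class of search problems solvable by such algorithms. A family $\{G_n:\{0,1\}^n\to\{0,1\}^{N(n)}\}$ with $N(n)>n$, computable by (possibly non-uniform) polynomial-size circuits, is a demi-bits generator (secure against $\mathbf{NP}/\mathrm{poly}$) if for every family $\{D\}$ of polynomial-size nondeterministic circuits and all sufficiently large $n$, it is not the case that both $\Pr_{y\sim\{0,1\}^{N(n)}}[D(y)=1]\ge 1/3$ and $D(G_n(x))=0$ for every $x\in\{0,1\}^n$. *)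

theory Defs
  imports Complex_Main
begin

text \<open>Wires 0..a-1 carry the inputs; wire a+i carries the value of gate i.
  A gate may only read wires with smaller index.\<close>

datatype gate = GConst bool | GNot nat | GAnd nat nat | GOr nat nat

datatype circuit = Circuit (ninputs: nat) (gates: "gate list") (outputs: "nat list")

fun gate_args :: "gate \<Rightarrow> nat list" where
  "gate_args (GConst b) = []"
| "gate_args (GNot i) = [i]"
| "gate_args (GAnd i j) = [i, j]"
| "gate_args (GOr i j) = [i, j]"

definition wf_circuit :: "circuit \<Rightarrow> bool" where
  "wf_circuit C \<longleftrightarrow>
     (\<forall>i < length (gates C). \<forall>j \<in> set (gate_args (gates C ! i)). j < ninputs C + i) \<and>
     (\<forall>w \<in> set (outputs C). w < ninputs C + length (gates C))"

fun gate_val :: "bool list \<Rightarrow> gate \<Rightarrow> bool" where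
  "gate_val vs (GConst b) = b"
| "gate_val vs (GNot i) = (\<not> vs ! i)"
| "gate_val vs (GAnd i j) = (vs ! i \<and> vs ! j)"
| "gate_val vs (GOr i j) = (vs ! i \<or> vs ! j)"

fun eval_gates :: "bool list \<Rightarrow> gate list \<Rightarrow> bool list" where
  "eval_gates vs [] = vs"
| "eval_gates vs (g # gs) = eval_gates (vs @ [gate_val vs g]) gs"

text \<open>Output of circuit C on input x (meaningful when length x = ninputs C).\<close>
definition eval_circuit :: "circuit \<Rightarrow> bool list \<Rightarrow> bool list" where
  "eval_circuit C x = (let vs = eval_gates x (gates C) in map (\<lambda>w. vs ! w) (outputs C))"

definition circuit_size :: "circuit \<Rightarrow> nat" where
  "circuit_size C = ninputs C + length (gates C) + length (outputs C)"

definition bitstrings :: "nat \<Rightarrow> bool list set" where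
  "bitstrings n = {x. length x = n}"

definition computes :: "circuit \<Rightarrow> nat \<Rightarrow> nat \<Rightarrow> (bool list \<Rightarrow> bool list) \<Rightarrow> bool" where
  "computes C a b f \<longleftrightarrow> wf_circuit C \<and> ninputs C = a \<and> length (outputs C) = b \<and>
     (\<forall>x \<in> bitstrings a. eval_circuit C x = f x)"

text \<open>Nondeterministic circuit on N input bits: a circuit with N + m inputs
  (the last m being nondeterministic witness bits) and one output;
  D(y) = 1 iff some witness w makes the circuit output 1.\<close>
definition nd_circuit :: "circuit \<Rightarrow> nat \<Rightarrow> bool" where
  "nd_circuit D N \<longleftrightarrow> wf_circuit D \<and> N \<le> ninputs D \<and> length (outputs D) = 1"

definition nd_eval :: "circuit \<Rightarrow> nat \<Rightarrow> bool list \<Rightarrow> bool" where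
  "nd_eval D N y \<longleftrightarrow> (\<exists>w \<in> bitstrings (ninputs D - N). eval_circuit D (y @ w) = [True])"

definition poly_bounded :: "(nat \<Rightarrow> nat) \<Rightarrow> bool" where
  "poly_bounded s \<longleftrightarrow> (\<exists>c k. \<forall>n. s n \<le> c * n ^ k + c)"

definition demibits_generator :: "(nat \<Rightarrow> bool list \<Rightarrow> bool list) \<Rightarrow> (nat \<Rightarrow> nat) \<Rightarrow> bool" where
  "demibits_generator G N \<longleftrightarrow>
     (\<forall>n > 0. N n > n) \<and>
     (\<exists>C. (\<forall>n. computes (C n) n (N n) (G n)) \<and> poly_bounded (\<lambda>n. circuit_size (C n))) \<and>
     (\<forall>D. (\<forall>n. nd_circuit (D n) (N n)) \<and> poly_bounded (\<lambda>n. circuit_size (D n)) \<longrightarrow>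
        (\<exists>n0. \<forall>n \<ge> n0.
           \<not> (real (card {y \<in> bitstrings (N n). nd_eval (D n) (N n) y}) / 2 ^ N n \<ge> 1/3 \<and>
              (\<forall>x \<in> bitstrings n. \<not> nd_eval (D n) (N n) (G n x)))))"

fun nat_bits :: "nat \<Rightarrow> bool list" where
  "nat_bits n = (if n = 0 then [] else odd n # nat_bits (n div 2))"

text \<open>Self-delimiting: each bit doubled, terminated by 01.\<close>
definition enc_nat :: "nat \<Rightarrow> bool list" where
  "enc_nat n = concat (map (\<lambda>b. [b, b]) (nat_bits n)) @ [False, True]"

definition enc_list :: "('a \<Rightarrow> bool list) \<Rightarrow> 'a list \<Rightarrow> bool list" where
  "enc_list e xs = enc_nat (length xs) @ concat (map e xs)"

fun enc_gate :: "gate \<Rightarrow> bool list" where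
  "enc_gate (GConst b) = enc_nat 0 @ enc_nat (if b then 1 else 0)"
| "enc_gate (GNot i) = enc_nat 1 @ enc_nat i"
| "enc_gate (GAnd i j) = enc_nat 2 @ enc_nat i @ enc_nat j"
| "enc_gate (GOr i j) = enc_nat 3 @ enc_nat i @ enc_nat j"

definition enc_circuit :: "circuit \<Rightarrow> bool list" where
  "enc_circuit C = enc_nat (ninputs C) @ enc_list enc_gate (gates C) @ enc_list enc_nat (outputs C)"

definition Avoid :: "bool list \<Rightarrow> bool list \<Rightarrow> bool" where
  "Avoid x y \<longleftrightarrow> (\<exists>C. x = enc_circuit C \<and> wf_circuit C \<and>
       length (outputs C) > ninputs C \<and>
       y \<in> bitstrings (length (outputs C)) \<and>
       y \<notin> eval_circuit C ` bitstrings (ninputs C))"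

text \<open>Single-tape NTM. Tape symbols are naturals: 0 = blank, 1 = bit 0, 2 = bit 1,
  further symbols are auxiliary. Transitions (q, s, q', s', d): in state q reading s,
  go to q', write s', move head by d \<in> {-1,0,1}.\<close>

datatype ntm = NTM (delta: "(nat \<times> nat \<times> nat \<times> nat \<times> int) set") (start_st: nat) (accept_st: nat)

type_synonym config = "nat \<times> (int \<Rightarrow> nat) \<times> int"

definition wf_ntm :: "ntm \<Rightarrow> bool" where
  "wf_ntm M \<longleftrightarrow> finite (delta M) \<and> (\<forall>(q, s, q', s', d) \<in> delta M. d \<in> {-1, 0, 1})"

definition ntm_step :: "ntm \<Rightarrow> config \<Rightarrow> config \<Rightarrow> bool" where
  "ntm_step M c c' \<longleftrightarrow> (case c of (q, t, h) \<Rightarrow>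
     (\<exists>q' s' d. (q, t h, q', s', d) \<in> delta M \<and> c' = (q', t(h := s'), h + d)))"

definition sym_of_bit :: "bool \<Rightarrow> nat" where
  "sym_of_bit b = (if b then 2 else 1)"

definition init_config :: "ntm \<Rightarrow> bool list \<Rightarrow> config" where
  "init_config M x = (start_st M,
     (\<lambda>i. if 0 \<le> i \<and> nat i < length x then sym_of_bit (x ! nat i) else 0), 0)"

definition halted :: "ntm \<Rightarrow> config \<Rightarrow> bool" where
  "halted M c \<longleftrightarrow> \<not> (\<exists>c'. ntm_step M c c')"

definition accepting_run :: "ntm \<Rightarrow> bool list \<Rightarrow> nat \<Rightarrow> config \<Rightarrow> bool" where
  "accepting_run M x k c \<longleftrightarrow> (ntm_step M ^^ k) (init_config M x) c \<and> halted M c \<and> fst c = accept_st M"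

definition tape_output :: "config \<Rightarrow> bool list" where
  "tape_output c = (case c of (q, t, h) \<Rightarrow>
     map (\<lambda>i. t (int i) = 2) [0..<(LEAST k. t (int k) \<notin> {1, 2})])"

definition ntm_poly_time :: "ntm \<Rightarrow> bool" where
  "ntm_poly_time M \<longleftrightarrow> (\<exists>c k. \<forall>x m cf. (ntm_step M ^^ m) (init_config M x) cf \<longrightarrow>
      m \<le> c * length x ^ k + c)"

definition solves_search :: "ntm \<Rightarrow> (bool list \<Rightarrow> bool list \<Rightarrow> bool) \<Rightarrow> bool" where
  "solves_search M R \<longleftrightarrow> (\<forall>x.
     ((\<exists>y. R x y) \<longrightarrow> (\<exists>k c. accepting_run M x k c) \<and>
                      (\<forall>k c. accepting_run M x k c \<longrightarrow> R x (tape_output c))) \<and>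
     ((\<nexists>y. R x y) \<longrightarrow> \<not> (\<exists>k c. accepting_run M x k c)))"

definition SearchNP :: "(bool list \<Rightarrow> bool list \<Rightarrow> bool) set" where
  "SearchNP = {R. \<exists>M. wf_ntm M \<and> ntm_poly_time M \<and> solves_search M R}"

end

theory Submission
  imports Defs "HOL-Analysis.Convex"
begin

text \<open>Let \<open>h u\<close> be the linear hash into \<open>m = n + 1\<close> bits given by a bit matrix \<open>u\<close>, and let
  \<open>S u\<close> be the circuit \<open>x \<mapsto> h u (G x)\<close>, an instance of range avoidance. If \<open>M\<close> solves range
  avoidance, accept \<open>y\<close> when some \<open>u\<close> and some accepting path of \<open>M\<close> on \<open>S u\<close> produce the output
  \<open>h u y\<close>. No \<open>G x\<close> is accepted, because \<open>h u (G x)\<close> lies in the range of \<open>S u\<close>. If \<open>y\<close> is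
  rejected, then \<open>h u y\<close> differs for every \<open>u\<close> from a fixed output \<open>f u\<close> of \<open>M\<close>; as the hash family
  is universal, a second moment argument bounds the number of such \<open>y\<close> by \<open>2 ^ (2 * m)\<close>, a small
  part of all \<open>2 ^ (10 * n)\<close> strings. The accepting path is guessed as a computation tableau, which
  makes the test a nondeterministic circuit of polynomial size and contradicts the security of
  \<open>G\<close>.\<close>

section \<open>Boolean formulas and circuits\<close>

lemma eval_gates_append: "eval_gates vs (gs @ hs) = eval_gates (eval_gates vs gs) hs"
  by (induction gs arbitrary: vs) auto

lemma length_eval_gates [simp]: "length (eval_gates vs gs) = length vs + length gs"
  by (induction gs arbitrary: vs) auto

lemma nth_eval_gates: "i < length vs \<Longrightarrow> eval_gates vs gs ! i = vs ! i"
  by (induction gs arbitrary: vs) (auto simp: nth_append)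

definition wf_gates :: "nat \<Rightarrow> gate list \<Rightarrow> bool" where
  "wf_gates k gs \<longleftrightarrow> (\<forall>i < length gs. \<forall>j \<in> set (gate_args (gs ! i)). j < k + i)"

lemma wf_gates_Nil [simp]: "wf_gates k []"
  by (simp add: wf_gates_def)

lemma wf_gates_Cons [simp]:
  "wf_gates k (g # gs) \<longleftrightarrow> (\<forall>j \<in> set (gate_args g). j < k) \<and> wf_gates (Suc k) gs"
  by (auto simp: wf_gates_def All_less_Suc2)

lemma wf_gates_append [simp]:
  "wf_gates k (gs @ hs) \<longleftrightarrow> wf_gates k gs \<and> wf_gates (k + length gs) hs"
  by (induction gs arbitrary: k) auto

lemma wf_circuit_iff:
  "wf_circuit C \<longleftrightarrow> wf_gates (ninputs C) (gates C) \<and>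
     (\<forall>w \<in> set (outputs C). w < ninputs C + length (gates C))"
  by (simp add: wf_circuit_def wf_gates_def)

text \<open>Intermediate language for building circuits, with variables of any type.
  \<open>FXor\<close> is a connective of its own because expanding it would duplicate both arguments
  and make long parities exponentially large.\<close>

datatype 'v fm = FConst bool | FVar 'v | FNot "'v fm" | FAnd "'v fm" "'v fm"
  | FOr "'v fm" "'v fm" | FXor "'v fm" "'v fm"

primrec fm_eval :: "('v \<Rightarrow> bool) \<Rightarrow> 'v fm \<Rightarrow> bool" where
  "fm_eval a (FConst b) = b"
| "fm_eval a (FVar v) = a v"
| "fm_eval a (FNot p) = (\<not> fm_eval a p)"
| "fm_eval a (FAnd p q) = (fm_eval a p \<and> fm_eval a q)"
| "fm_eval a (FOr p q) = (fm_eval a p \<or> fm_eval a q)"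
| "fm_eval a (FXor p q) = (fm_eval a p \<noteq> fm_eval a q)"

primrec fm_size :: "'v fm \<Rightarrow> nat" where
  "fm_size (FConst b) = 1"
| "fm_size (FVar v) = 1"
| "fm_size (FNot p) = fm_size p + 1"
| "fm_size (FAnd p q) = fm_size p + fm_size q + 1"
| "fm_size (FOr p q) = fm_size p + fm_size q + 1"
| "fm_size (FXor p q) = fm_size p + fm_size q + 1"

lemma fm_eval_map: "fm_eval a (map_fm f p) = fm_eval (a \<circ> f) p"
  by (induction p) auto

lemma fm_size_map [simp]: "fm_size (map_fm f p) = fm_size p"
  by (induction p) auto

lemma fm_eval_cong: "(\<And>v. v \<in> set_fm p \<Longrightarrow> a v = b v) \<Longrightarrow> fm_eval a p = fm_eval b p"
  by (induction p) auto

lemma finite_set_fm [simp]: "finite (set_fm p)"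
  by (induction p) auto

lemma card_set_fm: "card (set_fm p) \<le> fm_size p"
proof (induction p)
  case (FAnd p q) then show ?case using card_Un_le[of "set_fm p" "set_fm q"] by simp
next
  case (FOr p q) then show ?case using card_Un_le[of "set_fm p" "set_fm q"] by simp
next
  case (FXor p q) then show ?case using card_Un_le[of "set_fm p" "set_fm q"] by simp
qed auto

text \<open>Fragment to be appended after \<open>k\<close> existing wires. The result wire
  \<open>r\<close> may be an old one, so a variable costs no gate; the factor 4 pays for
  \<open>FXor\<close>, the dearest connective.\<close>

definition gates_compute :: "nat \<Rightarrow> nat fm \<Rightarrow> gate list \<Rightarrow> nat \<Rightarrow> bool" where
  "gates_compute k p gs r \<longleftrightarrow> wf_gates k gs \<and> length gs \<le> 4 * fm_size p \<and> r < k + length gs \<and>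
     (\<forall>vs. length vs = k \<longrightarrow> eval_gates vs gs ! r = fm_eval ((!) vs) p)"

text \<open>Common step for the binary connectives: \<open>ts\<close> joins the two results and
  carries the answer on its last wire. Although \<open>q\<close> is compiled on top of
  \<open>gs\<close>, it reads only the first \<open>k\<close> wires, whose values never
  change.\<close>

lemma gates_compute_binop:
  assumes p: "set_fm p \<subseteq> {..<k}" "gates_compute k p gs r"
    and q: "set_fm q \<subseteq> {..<k}" "gates_compute (k + length gs) q hs r'"
    and tl: "length ts \<le> 4" "ts \<noteq> []" "wf_gates (k + length gs + length hs) ts"
    and sz: "fm_size pq = fm_size p + fm_size q + 1"
    and ev: "\<And>vs. length vs = k + length gs + length hs \<Longrightarrow>
        last (eval_gates vs ts) = f (vs ! r) (vs ! r')"
      "\<And>a. fm_eval a pq = f (fm_eval a p) (fm_eval a q)"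
  shows "gates_compute k pq (gs @ hs @ ts) (k + length gs + length hs + length ts - 1)"
proof -
  have "eval_gates vs (gs @ hs @ ts) ! (k + length gs + length hs + length ts - 1)
        = fm_eval ((!) vs) pq" if vs: "length vs = k" for vs
  proof -
    let ?v1 = "eval_gates vs gs" let ?v2 = "eval_gates ?v1 hs"
    have "?v2 ! r = fm_eval ((!) vs) p"
      using p vs by (simp add: gates_compute_def nth_eval_gates)
    moreover have "?v2 ! r' = fm_eval ((!) ?v1) q"
      using q vs by (simp add: gates_compute_def)
    moreover have "fm_eval ((!) ?v1) q = fm_eval ((!) vs) q"
      using q vs by (intro fm_eval_cong) (auto simp: nth_eval_gates)
    moreover have "eval_gates ?v2 ts ! (k + length gs + length hs + length ts - 1)
        = last (eval_gates ?v2 ts)"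
      using tl vs by (subst last_conv_nth) (auto simp flip: length_greater_0_conv)
    ultimately show ?thesis using ev vs by (simp add: eval_gates_append)
  qed
  then show ?thesis
    using p q tl sz by (auto simp: gates_compute_def simp flip: length_greater_0_conv)
qed

lemma gates_compute_exists: "set_fm p \<subseteq> {..<k} \<Longrightarrow> \<exists>gs r. gates_compute k p gs r"
proof (induction p arbitrary: k)
  case (FConst b)
  have "gates_compute k (FConst b) [GConst b] k"
    by (auto simp: gates_compute_def)
  then show ?case by blast
next
  case (FVar v)
  then have "gates_compute k (FVar v) [] v"
    by (auto simp: gates_compute_def)
  then show ?case by blast
next
  case (FNot p)
  then obtain gs r where gs: "gates_compute k p gs r" by fastforce
  then have "gates_compute k (FNot p) (gs @ [GNot r]) (k + length gs)"
    by (auto simp: gates_compute_def eval_gates_append nth_append)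
  then show ?case by blast
next
  case (FAnd p q)
  then obtain gs r where gs: "gates_compute k p gs r" by fastforce
  have "set_fm q \<subseteq> {..<k + length gs}" using FAnd.prems by fastforce
  then obtain hs r' where hs: "gates_compute (k + length gs) q hs r'"
    using FAnd.IH by blast
  have "gates_compute k (FAnd p q) (gs @ hs @ [GAnd r r'])
      (k + length gs + length hs + length [GAnd r r'] - 1)"
    using gs hs FAnd.prems
    by (intro gates_compute_binop[OF _ gs _ hs, where f = "(\<and>)"]) (auto simp: gates_compute_def)
  then show ?case by blast
next
  case (FOr p q)
  then obtain gs r where gs: "gates_compute k p gs r" by fastforce
  have "set_fm q \<subseteq> {..<k + length gs}" using FOr.prems by fastforce
  then obtain hs r' where hs: "gates_compute (k + length gs) q hs r'"
    using FOr.IH by blast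
  have "gates_compute k (FOr p q) (gs @ hs @ [GOr r r'])
      (k + length gs + length hs + length [GOr r r'] - 1)"
    using gs hs FOr.prems
    by (intro gates_compute_binop[OF _ gs _ hs, where f = "(\<or>)"]) (auto simp: gates_compute_def)
  then show ?case by blast
next
  case (FXor p q)
  then obtain gs r where gs: "gates_compute k p gs r" by fastforce
  have "set_fm q \<subseteq> {..<k + length gs}" using FXor.prems by fastforce
  then obtain hs r' where hs: "gates_compute (k + length gs) q hs r'"
    using FXor.IH by blast
  let ?w = "k + length gs + length hs"
  \<comment> \<open>Exclusive or as \<open>(r or r') and not (r and r')\<close>; the four gates
    occupy the wires from \<open>?w\<close> on.\<close>
  let ?ts = "[GOr r r', GAnd r r', GNot (?w + 1), GAnd ?w (?w + 2)]"
  have "gates_compute k (FXor p q) (gs @ hs @ ?ts) (?w + length ?ts - 1)"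
    using gs hs FXor.prems
    by (intro gates_compute_binop[OF _ gs _ hs, where f = "(\<noteq>)"])
       (auto simp: gates_compute_def nth_append)
  then show ?case by blast
qed

text \<open>Gates only append wires, so the formulas can be compiled one after another without
  disturbing earlier results. This serves circuits with many outputs.\<close>

lemma gates_compute_list_exists:
  assumes "\<And>p. p \<in> set ps \<Longrightarrow> set_fm p \<subseteq> {..<k}"
  shows "\<exists>gs rs. wf_gates k gs \<and> length gs \<le> (\<Sum>p\<leftarrow>ps. 4 * fm_size p) \<and>
     length rs = length ps \<and> (\<forall>r \<in> set rs. r < k + length gs) \<and>
     (\<forall>vs. length vs = k \<longrightarrow> map ((!) (eval_gates vs gs)) rs = map (fm_eval ((!) vs)) ps)"
  using assms
proof (induction ps)
  case Nil
  show ?case by (intro exI[of _ "[]"]) auto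
next
  case (Cons p ps)
  then obtain gs rs where gs: "wf_gates k gs" "length gs \<le> (\<Sum>p\<leftarrow>ps. 4 * fm_size p)"
    "length rs = length ps" "\<forall>r \<in> set rs. r < k + length gs"
    "\<And>vs. length vs = k \<Longrightarrow> map ((!) (eval_gates vs gs)) rs = map (fm_eval ((!) vs)) ps"
    by force
  have "set_fm p \<subseteq> {..<k + length gs}" using Cons.prems by fastforce
  then obtain hs r where hs: "gates_compute (k + length gs) p hs r"
    using gates_compute_exists by blast
  have "map ((!) (eval_gates vs (gs @ hs))) (r # rs) = map (fm_eval ((!) vs)) (p # ps)"
    if "length vs = k" for vs
  proof -
    have "map ((!) (eval_gates vs (gs @ hs))) rs = map ((!) (eval_gates vs gs)) rs"
      using gs(4) that by (intro map_cong) (auto simp: eval_gates_append nth_eval_gates)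
    moreover have "eval_gates vs (gs @ hs) ! r = fm_eval ((!) (eval_gates vs gs)) p"
      using hs that by (simp add: gates_compute_def eval_gates_append)
    moreover have "\<dots> = fm_eval ((!) vs) p"
      using Cons.prems[of p] that by (intro fm_eval_cong) (auto simp: nth_eval_gates)
    ultimately show ?thesis using gs(5)[OF that] by simp
  qed
  then show ?case
    using gs hs by (intro exI[of _ "gs @ hs"] exI[of _ "r # rs"]) (auto simp: gates_compute_def)
qed

text \<open>Keeps formulas implicit: a predicate carries just a size bound, and the rules below
  derive such bounds along the shape of the predicate.\<close>

definition expressible :: "(('v \<Rightarrow> bool) \<Rightarrow> bool) \<Rightarrow> nat \<Rightarrow> bool" where
  "expressible P s \<longleftrightarrow> (\<exists>p. (\<forall>a. fm_eval a p = P a) \<and> fm_size p \<le> s)"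

lemma expressible_mono: "expressible P s \<Longrightarrow> s \<le> t \<Longrightarrow> expressible P t"
  unfolding expressible_def using le_trans by blast

lemma expressible_const: "expressible (\<lambda>a. b) 1"
  unfolding expressible_def by (intro exI[of _ "FConst b"]) auto

lemma expressible_var: "expressible (\<lambda>a. a v) 1"
  unfolding expressible_def by (intro exI[of _ "FVar v"]) auto

lemma expressible_not: "expressible P s \<Longrightarrow> expressible (\<lambda>a. \<not> P a) (s + 1)"
  unfolding expressible_def by (metis add_le_mono1 fm_eval.simps(3) fm_size.simps(3))

lemma expressible_and:
  assumes "expressible P s" "expressible Q t"
  shows "expressible (\<lambda>a. P a \<and> Q a) (s + t + 1)"
proof -
  obtain p q where "\<forall>a. fm_eval a p = P a" "fm_size p \<le> s" "\<forall>a. fm_eval a q = Q a" "fm_size q \<le> t"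
    using assms unfolding expressible_def by blast
  then show ?thesis unfolding expressible_def by (intro exI[of _ "FAnd p q"]) auto
qed

lemma expressible_xor:
  assumes "expressible P s" "expressible Q t"
  shows "expressible (\<lambda>a. P a \<noteq> Q a) (s + t + 1)"
proof -
  obtain p q where "\<forall>a. fm_eval a p = P a" "fm_size p \<le> s" "\<forall>a. fm_eval a q = Q a" "fm_size q \<le> t"
    using assms unfolding expressible_def by blast
  then show ?thesis unfolding expressible_def by (intro exI[of _ "FXor p q"]) auto
qed

lemma expressible_eq:
  "expressible P s \<Longrightarrow> expressible Q t \<Longrightarrow> expressible (\<lambda>a. P a = Q a) (s + t + 2)"
  using expressible_not[OF expressible_xor, of P s Q t] by simp

lemma expressible_Ball:
  assumes "finite I" "card I \<le> n" "\<And>i. i \<in> I \<Longrightarrow> expressible (P i) s"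
  shows "expressible (\<lambda>a. \<forall>i\<in>I. P i a) (n * (s + 1) + 1)"
proof -
  have "expressible (\<lambda>a. \<forall>i\<in>I. P i a) (card I * (s + 1) + 1)"
    using assms(1,3)
  proof (induction I)
    case empty
    then show ?case using expressible_const[of True] by simp
  next
    case (insert i I)
    then have "expressible (\<lambda>a. P i a \<and> (\<forall>i\<in>I. P i a)) (s + (card I * (s + 1) + 1) + 1)"
      by (intro expressible_and) auto
    then show ?case using insert by (simp add: algebra_simps)
  qed
  then show ?thesis
    using assms(2) by (rule expressible_mono[OF _ add_le_mono1[OF mult_le_mono1]])
qed

lemma expressible_Bex:
  assumes "finite I" "card I \<le> n" "\<And>i. i \<in> I \<Longrightarrow> expressible (P i) s"
  shows "expressible (\<lambda>a. \<exists>i\<in>I. P i a) (n * (s + 2) + 2)"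
  using expressible_not[OF expressible_Ball[OF assms(1,2), of "\<lambda>i a. \<not> P i a" "s + 1"]]
    expressible_not[OF assms(3)] by (simp add: algebra_simps)

text \<open>The variables \<open>inp i\<close> with \<open>i < N\<close> become the inputs and the
  remaining variables of the formula become witness bits, so quantifying over assignments turns into
  quantifying over witnesses. A formula of size \<open>s\<close> needs at most \<open>s\<close>
  witness bits and \<open>4 * s\<close> gates.\<close>

lemma nd_circuit_of_expressible:
  fixes inp :: "nat \<Rightarrow> 'v"
  assumes "expressible P s" "inj inp"
  shows "\<exists>D. nd_circuit D N \<and> circuit_size D \<le> N + 5 * s + 1 \<and>
    (\<forall>y \<in> bitstrings N. nd_eval D N y \<longleftrightarrow> (\<exists>a. (\<forall>i<N. a (inp i) = y ! i) \<and> P a))"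
proof -
  obtain p where p: "\<And>a. fm_eval a p = P a" "fm_size p \<le> s"
    using assms(1) by (auto simp: expressible_def)
  obtain vl where vl: "set vl = set_fm p - inp ` {..<N}" "distinct vl"
    using finite_distinct_list[of "set_fm p - inp ` {..<N}"] by auto
  have len: "length vl \<le> s"
    using card_set_fm[of p] p(2) card_mono[of "set_fm p" "set vl"] vl distinct_card[OF vl(2)] by auto
  \<comment> \<open>Wire of each variable: its input position, or \<open>N\<close> plus its position
    in the list \<open>vl\<close> of witness variables.\<close>
  define idx where "idx v = (if v \<in> inp ` {..<N} then inv inp v
    else N + (SOME i. i < length vl \<and> vl ! i = v))" for v
  have idx_inp: "idx (inp i) = i" if "i < N" for i
    using that assms(2) by (auto simp: idx_def)
  have idx_vl: "\<exists>i < length vl. vl ! i = v \<and> idx v = N + i" if "v \<in> set vl" for v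
  proof -
    have "\<exists>i. i < length vl \<and> vl ! i = v" using that by (auto simp: in_set_conv_nth)
    from someI_ex[OF this] show ?thesis using that vl by (auto simp: idx_def)
  qed
  have cases: "(\<exists>i<N. v = inp i) \<or> v \<in> set vl" if "v \<in> set_fm p" for v
    using that vl by auto
  let ?k = "N + length vl"
  have "set_fm (map_fm idx p) \<subseteq> {..<?k}"
    using cases idx_vl idx_inp by (fastforce simp: fm.set_map)
  then obtain gs r where gs: "gates_compute ?k (map_fm idx p) gs r"
    using gates_compute_exists by blast
  define D where "D = Circuit ?k gs [r]"
  have "nd_eval D N y \<longleftrightarrow> (\<exists>a. (\<forall>i<N. a (inp i) = y ! i) \<and> P a)" if y: "length y = N" for y
  proof
    assume "nd_eval D N y"
    then obtain w where w: "length w = length vl" "eval_circuit D (y @ w) = [True]"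
      by (auto simp: nd_eval_def D_def bitstrings_def)
    then have "fm_eval ((!) (y @ w) \<circ> idx) p"
      using gs y by (simp add: D_def eval_circuit_def Let_def gates_compute_def fm_eval_map)
    then show "\<exists>a. (\<forall>i<N. a (inp i) = y ! i) \<and> P a"
      using p(1) idx_inp y by (intro exI[of _ "(!) (y @ w) \<circ> idx"]) (auto simp: nth_append)
  next
    assume "\<exists>a. (\<forall>i<N. a (inp i) = y ! i) \<and> P a"
    then obtain a where a: "\<And>i. i < N \<Longrightarrow> a (inp i) = y ! i" "P a" by blast
    have "fm_eval ((!) (y @ map a vl) \<circ> idx) p = fm_eval a p"
    proof (rule fm_eval_cong)
      fix v assume "v \<in> set_fm p"
      then show "((!) (y @ map a vl) \<circ> idx) v = a v"
        using cases[of v] idx_inp idx_vl[of v] a y by (auto simp: nth_append)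
    qed
    then have "eval_circuit D (y @ map a vl) = [True]"
      using gs y a p by (simp add: D_def eval_circuit_def Let_def gates_compute_def fm_eval_map)
    then show "nd_eval D N y"
      by (auto simp: nd_eval_def D_def bitstrings_def intro!: exI[of _ "map a vl"])
  qed
  moreover have "nd_circuit D N"
    using gs by (simp add: nd_circuit_def D_def wf_circuit_iff gates_compute_def)
  moreover have "circuit_size D \<le> N + 5 * s + 1"
    using gs p len by (simp add: circuit_size_def D_def gates_compute_def)
  ultimately show ?thesis by (auto simp: bitstrings_def)
qed

section \<open>Encoding of circuits\<close>

text \<open>The remainders \<open>r\<close> and \<open>s\<close> allow codes to be peeled off a
  concatenation from the left; empty remainders give injectivity.\<close>

definition prefix_code :: "('a \<Rightarrow> bool list) \<Rightarrow> bool" where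
  "prefix_code e \<longleftrightarrow> (\<forall>x y r s. e x @ r = e y @ s \<longrightarrow> x = y \<and> r = s)"

lemma prefix_codeD: "prefix_code e \<Longrightarrow> e x @ r = e y @ s \<longleftrightarrow> x = y \<and> r = s"
  by (auto simp: prefix_code_def)

declare nat_bits.simps [simp del]

lemma nat_bits_0: "nat_bits 0 = []"
  by (subst nat_bits.simps) simp

lemma nat_bits_pos: "n > 0 \<Longrightarrow> nat_bits n = odd n # nat_bits (n div 2)"
  by (subst nat_bits.simps) simp

lemma inj_nat_bits: "nat_bits m = nat_bits n \<Longrightarrow> m = n"
proof (induction m arbitrary: n rule: less_induct)
  case (less m)
  show ?case
  proof (cases "m = 0 \<or> n = 0")
    case True
    then show ?thesis
      using less.prems by (cases "m = 0"; cases "n = 0") (auto simp: nat_bits_0 nat_bits_pos)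
  next
    case False
    then have "odd m = odd n" "nat_bits (m div 2) = nat_bits (n div 2)"
      using less.prems by (auto simp: nat_bits_pos)
    moreover from this have "m div 2 = n div 2" using False by (intro less.IH) auto
    ultimately show ?thesis by (metis bit_eq_rec)
  qed
qed

text \<open>The terminator consists of two different bits, so it is never mistaken for a doubled
  bit.\<close>

lemma doubled_bits_prefix:
  "concat (map (\<lambda>b. [b, b]) bs) @ [False, True] @ r = concat (map (\<lambda>b. [b, b]) cs) @ [False, True] @ s
    \<Longrightarrow> bs = cs \<and> r = s"
proof (induction bs arbitrary: cs)
  case Nil
  then show ?case by (cases cs) auto
next
  case (Cons b bs)
  then show ?case by (cases cs) auto
qed

lemma prefix_code_enc_nat: "prefix_code enc_nat"
  unfolding prefix_code_def enc_nat_def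
  using doubled_bits_prefix inj_nat_bits by (metis append.assoc)

lemmas enc_nat_prefix [simp] = prefix_codeD[OF prefix_code_enc_nat]

lemma prefix_code_enc_gate: "prefix_code enc_gate"
proof -
  have "enc_gate g @ r = enc_gate h @ s \<longrightarrow> g = h \<and> r = s" for g h r s
    by (cases g; cases h) auto
  then show ?thesis by (simp add: prefix_code_def)
qed

lemma prefix_code_enc_list:
  assumes "prefix_code e"
  shows "prefix_code (enc_list e)"
proof -
  have "concat (map e xs) @ r = concat (map e ys) @ s \<Longrightarrow> xs = ys \<and> r = s"
    if "length xs = length ys" for xs ys r s
    using that by (induction xs ys rule: list_induct2) (auto simp: prefix_codeD[OF assms])
  then show ?thesis by (auto simp: prefix_code_def enc_list_def)
qed

text \<open>\<open>Avoid\<close> speaks of some circuit with the given code; this makes that circuit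
  the intended one.\<close>

lemma inj_enc_circuit:
  assumes "enc_circuit C = enc_circuit C'"
  shows "C = C'"
proof -
  have "enc_circuit C @ [] = enc_circuit C' @ []" using assms by simp
  then have "ninputs C = ninputs C'" "gates C = gates C'" "outputs C = outputs C'"
    by (auto simp only: enc_circuit_def append.assoc enc_nat_prefix
      prefix_codeD[OF prefix_code_enc_list[OF prefix_code_enc_gate]]
      prefix_codeD[OF prefix_code_enc_list[OF prefix_code_enc_nat]])
  then show ?thesis by (rule circuit.expand[OF conjI[OF _ conjI]])
qed

lemma length_nat_bits: "length (nat_bits n) \<le> n"
proof (induction n rule: less_induct)
  case (less n)
  have "Suc (length (nat_bits (n div 2))) \<le> n" if "n > 0"
    using that less.IH[of "n div 2"] div_less_dividend[of 2 n] by linarith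
  then show ?case by (cases "n = 0") (auto simp: nat_bits_0 nat_bits_pos)
qed

lemma length_enc_nat: "length (enc_nat n) \<le> 2 * n + 2"
proof -
  have "length (concat (map (\<lambda>b. [b, b]) bs)) = 2 * length bs" for bs :: "bool list"
    by (induction bs) auto
  then show ?thesis using length_nat_bits[of n] by (simp add: enc_nat_def)
qed

lemma length_enc_gate:
  assumes "\<forall>j \<in> set (gate_args g). j < w"
  shows "length (enc_gate g) \<le> 4 * w + 12"
proof -
  have e: "length (enc_nat i) \<le> 2 * w + 2" if "i < w" for i
    using length_enc_nat[of i] that by simp
  have c: "length (enc_nat 0) = 2" "length (enc_nat (Suc 0)) = 4"
    "length (enc_nat 2) = 6" "length (enc_nat 3) = 6"
    by (simp_all add: enc_nat_def nat_bits_0 nat_bits_pos)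
  show ?thesis
  proof (cases g)
    case (GAnd i j)
    then show ?thesis using assms e[of i] e[of j] c by simp
  next
    case (GOr i j)
    then show ?thesis using assms e[of i] e[of j] c by simp
  next
    case (GNot i)
    then show ?thesis using assms e[of i] c by simp
  qed (use c in auto)
qed

lemma length_enc_list:
  assumes "\<And>x. x \<in> set xs \<Longrightarrow> length (e x) \<le> k"
  shows "length (enc_list e xs) \<le> 2 * length xs + 2 + length xs * k"
proof -
  have "length (concat (map e xs)) \<le> length xs * k"
    using assms by (induction xs) (auto intro!: add_mono)
  then show ?thesis using length_enc_nat[of "length xs"] by (simp add: enc_list_def)
qed

text \<open>There are at most \<open>s\<close> gates and \<open>s\<close> outputs, each naming wires
  below \<open>s\<close>. The crude linear bound on the code of a number suffices, as only
  polynomial growth matters.\<close>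

lemma length_enc_circuit:
  assumes "wf_circuit C" "circuit_size C \<le> s"
  shows "length (enc_circuit C) \<le> 6 * s * s + 20 * s + 6"
proof -
  have g: "length (enc_gate g) \<le> 4 * s + 12" if gC: "g \<in> set (gates C)" for g
  proof (rule length_enc_gate, intro ballI)
    fix j assume "j \<in> set (gate_args g)"
    moreover obtain i where "i < length (gates C)" "g = gates C ! i"
      using gC by (auto simp: in_set_conv_nth)
    ultimately have "j < ninputs C + i" "i < length (gates C)"
      using assms(1) by (auto simp: wf_circuit_def)
    then show "j < s" using assms(2) by (simp add: circuit_size_def)
  qed
  have o: "length (enc_nat w) \<le> 2 * s + 2" if "w \<in> set (outputs C)" for w
  proof -
    have "w < ninputs C + length (gates C)" using that assms(1) by (simp add: wf_circuit_def)
    then show ?thesis using assms(2) length_enc_nat[of w] by (simp add: circuit_size_def)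
  qed
  have "length (enc_list enc_gate (gates C)) \<le> 2 * length (gates C) + 2 + length (gates C) * (4 * s + 12)"
    using g by (rule length_enc_list)
  also have "\<dots> \<le> 2 * s + 2 + s * (4 * s + 12)"
    using assms by (intro add_mono mult_mono) (auto simp: circuit_size_def)
  finally have 1: "length (enc_list enc_gate (gates C)) \<le> 2 * s + 2 + s * (4 * s + 12)" .
  have "length (enc_list enc_nat (outputs C)) \<le> 2 * length (outputs C) + 2 + length (outputs C) * (2 * s + 2)"
    using o by (rule length_enc_list)
  also have "\<dots> \<le> 2 * s + 2 + s * (2 * s + 2)"
    using assms by (intro add_mono mult_mono) (auto simp: circuit_size_def)
  finally have 2: "length (enc_list enc_nat (outputs C)) \<le> 2 * s + 2 + s * (2 * s + 2)" .
  have 3: "length (enc_nat (ninputs C)) \<le> 2 * s + 2"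
    using assms length_enc_nat[of "ninputs C"] by (simp add: circuit_size_def)
  show ?thesis
    using 1 2 3 by (simp add: enc_circuit_def algebra_simps)
qed

text \<open>The seed is hardwired by choosing between \<open>GAnd\<close> and \<open>GOr\<close> on a false and a true wire:
  unlike those of \<open>GConst False\<close> and \<open>GConst True\<close>, the codes of these two gates have the same
  length, so that every bit of the encoded circuit is a constant or a bit of the seed.\<close>

definition seed_gate :: "nat \<Rightarrow> bool \<Rightarrow> gate" where
  "seed_gate w b = (if b then GOr w (Suc w) else GAnd w (Suc w))"

text \<open>Wire layout: \<open>n\<close> inputs, the gates \<open>gs\<close>, a false and a true
  wire, the seed, and \<open>hs\<close>. Seed bit \<open>l\<close> thus sits on wire
  \<open>n + length gs + 2 + l\<close>.\<close>

definition seeded_circuit :: "nat \<Rightarrow> gate list \<Rightarrow> gate list \<Rightarrow> nat list \<Rightarrow> bool list \<Rightarrow> circuit" where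
  "seeded_circuit n gs hs rs u = Circuit n
     (gs @ [GConst False, GConst True] @ map (seed_gate (n + length gs)) u @ hs) rs"

lemma eval_seed_gates:
  assumes "w + 1 < length vs" "\<not> vs ! w" "vs ! Suc w"
  shows "eval_gates vs (map (seed_gate w) u) = vs @ u"
  using assms
proof (induction u arbitrary: vs)
  case (Cons b u)
  have "gate_val vs (seed_gate w b) = b" using Cons.prems by (simp add: seed_gate_def)
  then show ?case using Cons.IH[of "vs @ [b]"] Cons.prems by (simp add: nth_append)
qed simp

lemma eval_seeded_circuit:
  assumes "length x = n"
  shows "eval_circuit (seeded_circuit n gs hs rs u) x =
    map ((!) (eval_gates (eval_gates x gs @ [False, True] @ u) hs)) rs"
proof -
  have "eval_gates (eval_gates x gs @ [False, True]) (map (seed_gate (n + length gs)) u)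
      = (eval_gates x gs @ [False, True]) @ u"
    using assms by (intro eval_seed_gates) (auto simp: nth_append)
  then show ?thesis
    by (simp add: eval_circuit_def seeded_circuit_def eval_gates_append)
qed

lemma wf_seeded_circuit:
  assumes "wf_gates n gs" "wf_gates (n + length gs + 2 + length u) hs"
    "\<forall>r \<in> set rs. r < n + length gs + 2 + length u + length hs"
  shows "wf_circuit (seeded_circuit n gs hs rs u)"
proof -
  have "wf_gates k (map (seed_gate w) u)" if "w + 1 < k" for w k u
    using that by (induction u arbitrary: k) (auto simp: seed_gate_def)
  then show ?thesis
    using assms by (simp add: wf_circuit_iff seeded_circuit_def add_ac)
qed

text \<open>Entry of a code template: \<open>Inl b\<close> is a fixed bit and \<open>Inr k\<close>
  stands for seed bit \<open>k\<close>.\<close>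

definition lit_val :: "(nat \<Rightarrow> bool) \<Rightarrow> bool + nat \<Rightarrow> bool" where
  "lit_val a l = (case l of Inl b \<Rightarrow> b | Inr k \<Rightarrow> a k)"

lemma lits_const: "map (lit_val a) (map Inl bs) = bs"
  by (induction bs) (auto simp: lit_val_def)

text \<open>The gate tags 2 and 3 differ only in their lowest binary digit, which comes first and is
  doubled by the code.\<close>

lemma enc_seed_gate:
  "enc_gate (seed_gate w b) = [b, b, True, True, False, True] @ enc_nat w @ enc_nat (Suc w)"
proof -
  have "nat_bits 2 = [False, True]" "nat_bits 3 = [True, True]"
    by (simp_all add: nat_bits_0 nat_bits_pos)
  then show ?thesis by (simp add: seed_gate_def enc_nat_def)
qed

lemma enc_seed_gates_lits:
  "\<exists>ls. Inr ` {p..} \<inter> set ls = {} \<and> (\<forall>u. length u = p \<longrightarrow>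
     concat (map (enc_gate \<circ> seed_gate w) u) = map (lit_val ((!) u)) ls)"
proof (intro exI conjI allI impI)
  fix u :: "bool list" assume u: "length u = p"
  let ?tl = "[True, True, False, True] @ enc_nat w @ enc_nat (Suc w)"
  have "concat (map (enc_gate \<circ> seed_gate w) (map ((!) u) [0..<p])) =
      map (lit_val ((!) u)) (concat (map (\<lambda>k. [Inr k, Inr k] @ map Inl ?tl) [0..<p]))"
    unfolding map_concat map_map comp_def map_append[of "lit_val _"] lits_const enc_seed_gate
    by (simp add: lit_val_def)
  then show "concat (map (enc_gate \<circ> seed_gate w) u) =
      map (lit_val ((!) u)) (concat (map (\<lambda>k. [Inr k, Inr k] @ map Inl ?tl) [0..<p]))"
    using map_nth[of u] u by (simp only:)
qed auto

text \<open>Outside the seed gates the code depends on \<open>u\<close> only through its length, so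
  one template serves all seeds. It becomes the initial tape of a tableau whose seed is still a
  variable.\<close>

lemma enc_seeded_circuit_lits:
  "\<exists>ls. Inr ` {p..} \<inter> set ls = {} \<and> (\<forall>u. length u = p \<longrightarrow>
     enc_circuit (seeded_circuit n gs hs rs u) = map (lit_val ((!) u)) ls)"
proof -
  obtain ls where ls_idx: "Inr ` {p..} \<inter> set ls = {}" and ls: "\<And>u. length u = p \<Longrightarrow>
     concat (map (enc_gate \<circ> seed_gate (n + length gs)) u) = map (lit_val ((!) u)) ls"
    using enc_seed_gates_lits by metis
  let ?pre = "enc_nat n @ enc_nat (length gs + 2 + p + length hs) @ concat (map enc_gate gs) @
    enc_gate (GConst False) @ enc_gate (GConst True)"
  let ?post = "concat (map enc_gate hs) @ enc_list enc_nat rs"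
  have "enc_circuit (seeded_circuit n gs hs rs u) =
      map (lit_val ((!) u)) (map Inl ?pre @ ls @ map Inl ?post)" if "length u = p" for u
    unfolding map_append[of "lit_val _"] lits_const ls[OF that, symmetric]
    using that by (simp add: enc_circuit_def seeded_circuit_def enc_list_def add_ac)
  moreover have "Inr ` {p..} \<inter> set (map Inl ?pre @ ls @ map Inl ?post) = {}"
    using ls_idx by auto
  ultimately show ?thesis by blast
qed

section \<open>Universal hashing\<close>

text \<open>Second moment method: under each \<open>u\<close> the set \<open>S\<close> spreads over
  at most \<open>card Z - 1\<close> buckets, since the bucket \<open>f u\<close> is empty.
  Cauchy-Schwarz then forces many collisions, while universality allows few on average over
  \<open>u\<close>.\<close>

lemma universal_hash_avoid:
  fixes h :: "'u \<Rightarrow> 'y \<Rightarrow> 'z"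
  assumes fin: "finite U" "U \<noteq> {}" "finite S" "finite Z"
    and h: "\<And>u y. u \<in> U \<Longrightarrow> y \<in> S \<Longrightarrow> h u y \<in> Z"
    and f: "\<And>u. u \<in> U \<Longrightarrow> f u \<in> Z"
    and avoid: "\<And>u y. u \<in> U \<Longrightarrow> y \<in> S \<Longrightarrow> h u y \<noteq> f u"
    and coll: "\<And>y y'. y \<in> S \<Longrightarrow> y' \<in> S \<Longrightarrow> y \<noteq> y' \<Longrightarrow>
      card {u \<in> U. h u y = h u y'} * card Z \<le> card U"
  shows "card S \<le> card Z * card Z"
proof (cases "S = {}")
  case False
  let ?M = "real (card Z)" and ?S = "real (card S)" and ?U = "real (card U)"
  \<comment> \<open>Load of bucket \<open>z\<close> under \<open>u\<close>; by \<open>sq\<close>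
    below, the squared loads add up to the number of colliding ordered pairs.\<close>
  define c where "c u z = (\<Sum>y\<in>S. of_bool (h u y = z) :: real)" for u z
  have Z: "card Z > 0" using fin f by (auto simp: card_gt_0_iff)
  have pos: "?S > 0" "?U > 0" using False fin by (auto simp: card_gt_0_iff)
  have sq: "(\<Sum>z\<in>Z. (c u z)\<^sup>2) = (\<Sum>y\<in>S. \<Sum>y'\<in>S. of_bool (h u y = h u y'))" if "u \<in> U" for u
  proof -
    have "(\<Sum>z\<in>Z. (c u z)\<^sup>2) =
        (\<Sum>z\<in>Z. \<Sum>y\<in>S. \<Sum>y'\<in>S. of_bool (h u y = z) * of_bool (h u y' = z))"
      by (simp add: c_def power2_eq_square sum_product)
    also have "\<dots> = (\<Sum>y\<in>S. \<Sum>y'\<in>S. \<Sum>z\<in>Z. of_bool (h u y = z) * of_bool (h u y' = z))"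
      by (subst sum.swap, rule sum.cong[OF refl], rule sum.swap)
    also have "\<dots> = (\<Sum>y\<in>S. \<Sum>y'\<in>S. of_bool (h u y = h u y'))"
    proof (intro sum.cong refl)
      fix y y' assume "y \<in> S" "y' \<in> S"
      have "(\<Sum>z\<in>Z. of_bool (h u y = z) * of_bool (h u y' = z) :: real) =
          (\<Sum>z\<in>Z. if h u y = z then of_bool (h u y = h u y') else 0)"
        by (intro sum.cong) auto
      then show "(\<Sum>z\<in>Z. of_bool (h u y = z) * of_bool (h u y' = z) :: real) = of_bool (h u y = h u y')"
        using h[OF \<open>u \<in> U\<close> \<open>y \<in> S\<close>] fin by simp
    qed
    finally show ?thesis .
  qed
  have "?S\<^sup>2 \<le> (?M - 1) * (\<Sum>z\<in>Z. (c u z)\<^sup>2)" if u: "u \<in> U" for u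
  proof -
    \<comment> \<open>Every element of \<open>S\<close> lies in exactly one bucket other than
      \<open>f u\<close>.\<close>
    have "?S = (\<Sum>y\<in>S. \<Sum>z\<in>Z - {f u}. of_bool (h u y = z))"
    proof -
      have "(\<Sum>z\<in>Z - {f u}. of_bool (h u y = z) :: real) = 1" if "y \<in> S" for y
        using h[OF u that] avoid[OF u that] fin by (simp add: of_bool_def)
      then show ?thesis by simp
    qed
    also have "\<dots> = (\<Sum>z\<in>Z - {f u}. c u z)"
      unfolding c_def by (rule sum.swap)
    finally have "?S\<^sup>2 \<le> (\<Sum>z\<in>Z - {f u}. (c u z)\<^sup>2) * card (Z - {f u})"
      using sum_squared_le_sum_of_squares[of "c u" "Z - {f u}"] by simp
    also have "\<dots> \<le> (\<Sum>z\<in>Z. (c u z)\<^sup>2) * (?M - 1)"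
      using f[OF u] fin Z by (intro mult_mono sum_mono2) (auto simp: of_nat_diff intro: sum_nonneg)
    finally show ?thesis by (simp add: mult.commute)
  qed
  then have "(\<Sum>u\<in>U. ?S\<^sup>2) \<le> (\<Sum>u\<in>U. (?M - 1) * (\<Sum>z\<in>Z. (c u z)\<^sup>2))"
    by (rule sum_mono)
  then have "?U * ?S\<^sup>2 \<le> (?M - 1) * (\<Sum>u\<in>U. \<Sum>z\<in>Z. (c u z)\<^sup>2)"
    by (simp add: sum_distrib_left)
  also have "(\<Sum>u\<in>U. \<Sum>z\<in>Z. (c u z)\<^sup>2) = (\<Sum>u\<in>U. \<Sum>y\<in>S. \<Sum>y'\<in>S. of_bool (h u y = h u y'))"
    using sq by simp
  also have "\<dots> = (\<Sum>y\<in>S. \<Sum>y'\<in>S. \<Sum>u\<in>U. of_bool (h u y = h u y'))"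
    by (subst sum.swap, rule sum.cong[OF refl], rule sum.swap)
  \<comment> \<open>Equal pairs collide for all \<open>u\<close>, distinct ones for a fraction of at
    most \<open>1 / ?M\<close>. The second term is granted to equal pairs too, which keeps the sum
    simple.\<close>
  also have "\<dots> \<le> (\<Sum>y\<in>S. \<Sum>y'\<in>S. (if y = y' then ?U else 0) + ?U / ?M)"
  proof (intro sum_mono)
    fix y y' assume y: "y \<in> S" "y' \<in> S"
    have eq: "(\<Sum>u\<in>U. of_bool (h u y = h u y') :: real) = card {u \<in> U. h u y = h u y'}"
      using fin by (simp add: of_bool_def sum.If_cases Int_def)
    show "(\<Sum>u\<in>U. of_bool (h u y = h u y')) \<le> (if y = y' then ?U else 0) + ?U / ?M"
    proof (cases "y = y'")
      case False
      have "real (card {u \<in> U. h u y = h u y'} * card Z) \<le> ?U"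
        using coll[OF y False] by (simp only: of_nat_le_iff)
      then show ?thesis unfolding eq using False Z by (simp add: field_simps)
    qed (auto simp: of_bool_def)
  qed
  also have "\<dots> = ?U * ?S + ?S * ?S * ?U / ?M"
    using fin by (simp add: sum.distrib algebra_simps)
  finally have "?U * ?S\<^sup>2 \<le> (?M - 1) * (?U * ?S + ?S * ?S * ?U / ?M)"
    using Z by (simp add: mult_left_mono)
  also have "\<dots> = (?U * ?S) * ((?M - 1) * (1 + ?S / ?M))"
    by (simp add: algebra_simps)
  finally have "(?U * ?S) * ?S \<le> (?U * ?S) * ((?M - 1) * (1 + ?S / ?M))"
    by (simp add: power2_eq_square algebra_simps)
  \<comment> \<open>After cancelling \<open>?U * ?S\<close>, the factor \<open>?M - 1\<close>
    instead of \<open>?M\<close> is decisive: the terms \<open>?S * ?M\<close> on both sides cancel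
    and a bound on \<open>?S\<close> remains.\<close>
  then have "?S \<le> (?M - 1) * (1 + ?S / ?M)"
    using pos by (subst (asm) mult_le_cancel_left_pos) auto
  then have "?S * ?M \<le> (?M - 1) * (?M + ?S)"
    using Z by (simp add: field_simps)
  then have "?S \<le> ?M * ?M" using Z by (simp add: algebra_simps)
  then show ?thesis by (metis of_nat_le_iff of_nat_mult)
qed simp

section \<open>Linear hashing over the two-element field\<close>

lemma bitstrings_eq: "bitstrings n = {xs. set xs \<subseteq> UNIV \<and> length xs = n}"
  by (simp add: bitstrings_def)

lemma finite_bitstrings [simp]: "finite (bitstrings n)"
  unfolding bitstrings_eq by (rule finite_lists_length_eq) simp

lemma card_bitstrings [simp]: "card (bitstrings n) = 2 ^ n"
  unfolding bitstrings_eq by (subst card_lists_length_eq) auto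

primrec parity_upto :: "(nat \<Rightarrow> bool) \<Rightarrow> nat \<Rightarrow> bool" where
  "parity_upto f 0 = False"
| "parity_upto f (Suc n) = (parity_upto f n \<noteq> f n)"

lemma parity_upto_xor: "parity_upto (\<lambda>j. f j \<noteq> g j) n = (parity_upto f n \<noteq> parity_upto g n)"
  by (induction n) auto

lemma parity_upto_cong: "(\<And>j. j < n \<Longrightarrow> f j = g j) \<Longrightarrow> parity_upto f n = parity_upto g n"
  by (induction n) auto

lemma parity_upto_single: "parity_upto (\<lambda>j. j = k \<and> b) n = (k < n \<and> b)"
  by (induction n) (auto simp: less_Suc_eq)

lemma expressible_parity_upto:
  assumes "\<And>j. j < n \<Longrightarrow> expressible (\<lambda>a. f j a) s"
  shows "expressible (\<lambda>a. parity_upto (\<lambda>j. f j a) n) (n * (s + 1) + 1)"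
  using assms
proof (induction n)
  case 0
  then show ?case using expressible_const[of False] by simp
next
  case (Suc n)
  then have "expressible (\<lambda>a. parity_upto (\<lambda>j. f j a) n \<noteq> f n a) ((n * (s + 1) + 1) + s + 1)"
    by (intro expressible_xor) auto
  then show ?case by (simp add: algebra_simps)
qed

text \<open>The seed lists the rows of an \<open>m \<times> N\<close> matrix over the two-element field.\<close>

definition linear_hash :: "nat \<Rightarrow> nat \<Rightarrow> bool list \<Rightarrow> bool list \<Rightarrow> bool list" where
  "linear_hash N m u y = map (\<lambda>i. parity_upto (\<lambda>j. u ! (i * N + j) \<and> y ! j) N) [0..<m]"

lemma matrix_index_less:
  fixes i j :: nat
  assumes "i < m" "j < N"
  shows "i * N + j < m * N"
proof -
  have "i * N + j < Suc i * N" using assms(2) by simp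
  also have "\<dots> \<le> m * N" using assms(1) by (intro mult_le_mono1) simp
  finally show ?thesis .
qed

text \<open>Take a position \<open>k\<close> where \<open>y\<close> and \<open>y'\<close> differ.
  Adding a vector \<open>z\<close> to column \<open>k\<close> of the matrix adds \<open>z\<close> to
  the difference of the hash values. From a colliding matrix so modified, both \<open>z\<close> and
  the matrix can be recovered, so colliding matrices paired with vectors inject into all
  matrices.\<close>

lemma card_linear_hash_collision:
  assumes y: "length y = N" "length y' = N" "y \<noteq> y'"
  shows "card {u \<in> bitstrings (m * N). linear_hash N m u y = linear_hash N m u y'} * 2 ^ m \<le> 2 ^ (m * N)"
proof -
  obtain k where k: "k < N" "y ! k \<noteq> y' ! k" using y nth_equalityI[of y y'] by auto
  \<comment> \<open>Row \<open>i\<close> of the difference of the two hash values, which by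
    linearity is the hash of the difference of \<open>y\<close> and \<open>y'\<close>.\<close>
  define d where "d u i = parity_upto (\<lambda>j. u ! (i * N + j) \<and> y ! j \<noteq> y' ! j) N" for u i
  have d: "d u i = (parity_upto (\<lambda>j. u ! (i * N + j) \<and> y ! j) N \<noteq>
      parity_upto (\<lambda>j. u ! (i * N + j) \<and> y' ! j) N)" for u i
    unfolding d_def parity_upto_xor[symmetric] by (rule parity_upto_cong) auto
  let ?K = "{u \<in> bitstrings (m * N). linear_hash N m u y = linear_hash N m u y'}"
  have K: "\<not> d u i" if "u \<in> ?K" "i < m" for u i
    using that by (auto simp: d linear_hash_def)
  \<comment> \<open>Entry \<open>l\<close> lies in row \<open>l div N\<close> and column
    \<open>l mod N\<close>; only column \<open>k\<close> is altered.\<close>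
  define flip where "flip u z = map (\<lambda>l. u ! l \<noteq> (l mod N = k \<and> z ! (l div N))) [0..<m * N]"
    for u z
  have d_flip: "d (flip u z) i = (d u i \<noteq> z ! i)" if "i < m" for u z i
  proof -
    have "d (flip u z) i =
        parity_upto (\<lambda>j. (u ! (i * N + j) \<and> y ! j \<noteq> y' ! j) \<noteq> (j = k \<and> z ! i)) N"
      unfolding d_def
    proof (rule parity_upto_cong)
      fix j assume "j < N"
      then have "flip u z ! (i * N + j) = (u ! (i * N + j) \<noteq> (j = k \<and> z ! i))"
        using matrix_index_less[OF \<open>i < m\<close> \<open>j < N\<close>] by (simp add: flip_def)
      then show "(flip u z ! (i * N + j) \<and> y ! j \<noteq> y' ! j) =
          ((u ! (i * N + j) \<and> y ! j \<noteq> y' ! j) \<noteq> (j = k \<and> z ! i))"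
        using k by auto
    qed
    also have "\<dots> = (d u i \<noteq> z ! i)"
      unfolding parity_upto_xor parity_upto_single d_def using k(1) by simp
    finally show ?thesis .
  qed
  have "inj_on (\<lambda>(u, z). flip u z) (?K \<times> bitstrings m)"
  proof (rule inj_onI, clarify)
    fix u z u' z'
    assume uz: "u \<in> bitstrings (m * N)" "linear_hash N m u y = linear_hash N m u y'"
        "z \<in> bitstrings m" "u' \<in> bitstrings (m * N)"
        "linear_hash N m u' y = linear_hash N m u' y'" "z' \<in> bitstrings m"
      and eq: "flip u z = flip u' z'"
    have "z ! i = z' ! i" if "i < m" for i
    proof -
      have "\<not> d u i" "\<not> d u' i" using K uz that by blast+
      then show ?thesis using d_flip[OF that, of u z] d_flip[OF that, of u' z'] eq by simp
    qed
    then have z: "z = z'" using uz by (auto simp: bitstrings_def intro: nth_equalityI)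
    have "u ! l = u' ! l" if "l < m * N" for l
    proof -
      have "flip u z ! l = flip u' z ! l" using eq z by simp
      then show ?thesis using that by (auto simp: flip_def)
    qed
    then show "u = u' \<and> z = z'" using z uz by (auto simp: bitstrings_def intro: nth_equalityI)
  qed
  then have "card (?K \<times> bitstrings m) \<le> card (bitstrings (m * N))"
    by (rule card_inj_on_le[OF _ _ finite_bitstrings]) (auto simp: flip_def bitstrings_def)
  then show ?thesis by (simp add: card_cartesian_product)
qed

lemma length_linear_hash [simp]: "length (linear_hash N m u y) = m"
  by (simp add: linear_hash_def)

lemma linear_hash_avoid:
  assumes S: "S \<subseteq> bitstrings N" and f: "\<And>u. u \<in> bitstrings (m * N) \<Longrightarrow> f u \<in> bitstrings m"
    and avoid: "\<And>u y. u \<in> bitstrings (m * N) \<Longrightarrow> y \<in> S \<Longrightarrow> linear_hash N m u y \<noteq> f u"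
  shows "card S \<le> 2 ^ m * 2 ^ m"
proof -
  have "card S \<le> card (bitstrings m) * card (bitstrings m)"
  proof (rule universal_hash_avoid[OF _ _ _ _ _ f avoid])
    show "bitstrings (m * N) \<noteq> {}" using Ex_list_of_length[of "m * N"] by (auto simp: bitstrings_def)
    show "finite S" using finite_subset[OF S] by simp
    show "linear_hash N m u y \<in> bitstrings m" for u y by (simp add: bitstrings_def)
    show "card {u \<in> bitstrings (m * N). linear_hash N m u y = linear_hash N m u y'}
        * card (bitstrings m) \<le> card (bitstrings (m * N))"
      if "y \<in> S" "y' \<in> S" "y \<noteq> y'" for y y'
    proof -
      have "length y = N" "length y' = N" using that S by (auto simp: bitstrings_def)
      then show ?thesis using card_linear_hash_collision[of y N y' m] that(3) by simp
    qed
  qed auto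
  then show ?thesis by simp
qed

section \<open>Computation tableaux\<close>

text \<open>\<open>In\<close> holds the string \<open>y\<close> under test. Everything else is
  guessed: the hash matrix, and for each time the state, the head cell and the tape symbols, each in
  one-hot form.\<close>

datatype var = In nat | Seed nat | St nat nat | Hd nat int | Sy nat int nat

text \<open>The start and accepting states are included even if no transition mentions them, so that
  tableau rows constrain their variables.\<close>

definition states :: "ntm \<Rightarrow> nat set" where
  "states M = {start_st M, accept_st M} \<union> (\<Union>(q, s, q', s', d) \<in> delta M. {q, q'})"

definition symbols :: "ntm \<Rightarrow> nat set" where
  "symbols M = {0, 1, 2} \<union> (\<Union>(q, s, q', s', d) \<in> delta M. {s, s'})"

text \<open>Idle transitions pad every run to the same length; halting is tested separately.\<close>

definition moves :: "ntm \<Rightarrow> (nat \<times> nat \<times> nat \<times> nat \<times> int) set" where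
  "moves M = delta M \<union> (\<lambda>(q, s). (q, s, q, s, 0)) ` (states M \<times> symbols M)"

definition cells :: "nat \<Rightarrow> int set" where
  "cells B = {- int B..int B}"

text \<open>Invariant of a run after \<open>t\<close> steps: the head drifts by at most one cell per
  step, so a fixed window of cells holds everything that is not blank.\<close>

definition bounded_config :: "ntm \<Rightarrow> nat \<Rightarrow> nat \<Rightarrow> config \<Rightarrow> bool" where
  "bounded_config M B t c \<longleftrightarrow> (case c of (q, tp, h) \<Rightarrow>
     q \<in> states M \<and> range tp \<subseteq> symbols M \<and> \<bar>h\<bar> \<le> int t \<and> (\<forall>j. j \<notin> cells B \<longrightarrow> tp j = 0))"

definition describes :: "ntm \<Rightarrow> nat \<Rightarrow> (var \<Rightarrow> bool) \<Rightarrow> nat \<Rightarrow> config \<Rightarrow> bool" where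
  "describes M B a t c \<longleftrightarrow>
     (\<forall>q \<in> states M. a (St t q) = (q = fst c)) \<and>
     (\<forall>j \<in> cells B. a (Hd t j) = (j = snd (snd c))) \<and>
     (\<forall>j \<in> cells B. \<forall>s \<in> symbols M. a (Sy t j s) = (fst (snd c) j = s))"

definition move_formula ::
  "ntm \<Rightarrow> nat \<Rightarrow> nat \<Rightarrow> int \<Rightarrow> nat \<times> nat \<times> nat \<times> nat \<times> int \<Rightarrow> (var \<Rightarrow> bool) \<Rightarrow> bool" where
  "move_formula M B t i mv a \<longleftrightarrow> (case mv of (q, s, q', s', d) \<Rightarrow>
     a (Hd t i) \<and> a (St t q) \<and> a (Sy t i s) \<and>
     (\<forall>r \<in> states M. a (St (Suc t) r) = (r = q')) \<and>
     (\<forall>j \<in> cells B. a (Hd (Suc t) j) = (j = i + d)) \<and>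
     (\<forall>j \<in> cells B. \<forall>r \<in> symbols M. a (Sy (Suc t) j r) = (if j = i then s' = r else a (Sy t j r))))"

definition step_formula :: "ntm \<Rightarrow> nat \<Rightarrow> nat \<Rightarrow> (var \<Rightarrow> bool) \<Rightarrow> bool" where
  "step_formula M B t a \<longleftrightarrow> (\<exists>i \<in> cells B. \<exists>mv \<in> moves M. move_formula M B t i mv a)"

text \<open>Halting refers to \<open>delta M\<close>, because the idle transitions of
  \<open>moves M\<close> never run out. Both bit symbols are tested since a cell may also be blank
  or auxiliary; cell \<open>m\<close> must hold neither, which fixes the output length at
  \<open>m\<close>.\<close>

definition final_formula ::
  "ntm \<Rightarrow> nat \<Rightarrow> nat \<Rightarrow> nat \<Rightarrow> (nat \<Rightarrow> (var \<Rightarrow> bool) \<Rightarrow> bool) \<Rightarrow> (var \<Rightarrow> bool) \<Rightarrow> bool" where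
  "final_formula M B t m f a \<longleftrightarrow>
     a (St t (accept_st M)) \<and>
     (\<forall>i \<in> cells B. \<forall>mv \<in> delta M. \<not> (a (Hd t i) \<and> a (St t (fst mv)) \<and> a (Sy t i (fst (snd mv))))) \<and>
     (\<forall>i \<in> {..<m}. (a (Sy t (int i) 2) = f i a) \<and> (a (Sy t (int i) 1) = (\<not> f i a))) \<and>
     \<not> a (Sy t (int m) 1) \<and> \<not> a (Sy t (int m) 2)"

section \<open>Correctness of the tableau formulas\<close>

lemma delta_statesD: "(q, s, q', s', d) \<in> delta M \<Longrightarrow> q \<in> states M \<and> q' \<in> states M"
  by (force simp: states_def)

lemma delta_symbolsD: "(q, s, q', s', d) \<in> delta M \<Longrightarrow> s \<in> symbols M \<and> s' \<in> symbols M"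
  by (force simp: symbols_def)

lemma bit_symbols [simp]: "0 \<in> symbols M" "Suc 0 \<in> symbols M" "2 \<in> symbols M"
  by (auto simp: symbols_def)

lemma special_states [simp]: "start_st M \<in> states M" "accept_st M \<in> states M"
  by (auto simp: states_def)

lemma moves_cases:
  assumes "(q, s, q', s', d) \<in> moves M"
  shows "q \<in> states M \<and> s \<in> symbols M \<and> q' \<in> states M \<and> s' \<in> symbols M"
  using assms by (auto simp: moves_def dest: delta_statesD delta_symbolsD)

lemma finite_machine:
  assumes "wf_ntm M"
  shows "finite (states M)" "finite (symbols M)" "finite (moves M)"
proof -
  have "finite (delta M)" using assms by (simp add: wf_ntm_def)
  then show "finite (states M)" "finite (symbols M)"
    by (auto simp: states_def symbols_def split: prod.split)
  then show "finite (moves M)" using \<open>finite (delta M)\<close> by (simp add: moves_def)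
qed

lemma bounded_step:
  assumes "wf_ntm M" "bounded_config M B t c" "t < B" "ntm_step M c c'"
  shows "bounded_config M B (Suc t) c'"
proof -
  obtain q tp h where c: "c = (q, tp, h)" by (cases c)
  with assms(4) obtain q' s' d where d: "(q, tp h, q', s', d) \<in> delta M"
    "c' = (q', tp(h := s'), h + d)" by (auto simp: ntm_step_def)
  then have "d \<in> {-1, 0, 1}" using assms(1) by (auto simp: wf_ntm_def)
  moreover have "h \<in> cells B" using assms(2,3) c by (auto simp: bounded_config_def cells_def)
  ultimately show ?thesis
    using assms(2) d delta_statesD[OF d(1)] delta_symbolsD[OF d(1)]
    by (auto simp: bounded_config_def c)
qed

lemma bounded_Suc: "bounded_config M B t c \<Longrightarrow> bounded_config M B (Suc t) c"
  by (auto simp: bounded_config_def)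

lemma bounded_init:
  assumes "length x \<le> B"
  shows "bounded_config M B 0 (init_config M x)"
  using assms by (auto simp: bounded_config_def init_config_def cells_def sym_of_bit_def)

text \<open>An idle transition writes back the symbol it reads. It is available here because a
  bounded configuration uses only listed states and symbols.\<close>

lemma step_or_idle_iff:
  assumes "bounded_config M B t (q, tp, h)"
  shows "ntm_step M (q, tp, h) c' \<or> c' = (q, tp, h) \<longleftrightarrow>
    (\<exists>q' s' d. (q, tp h, q', s', d) \<in> moves M \<and> c' = (q', tp(h := s'), h + d))" (is "?l \<longleftrightarrow> ?r")
proof
  assume ?l
  then show ?r
  proof
    assume "c' = (q, tp, h)"
    moreover have "(q, tp h) \<in> states M \<times> symbols M"
      using assms by (auto simp: bounded_config_def)
    then have "(q, tp h, q, tp h, 0) \<in> moves M"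
      unfolding moves_def by (intro UnI2 image_eqI[of _ _ "(q, tp h)"]) auto
    ultimately show ?r by (metis add.right_neutral fun_upd_triv)
  qed (auto simp: ntm_step_def moves_def)
qed (auto simp: ntm_step_def moves_def)

text \<open>The one-hot row \<open>t\<close> admits a single head cell, state and read symbol. What
  is left of \<open>move_formula\<close> then prescribes row \<open>Suc t\<close> completely, as the
  description of the successor.\<close>

lemma step_formula_iff:
  assumes c: "bounded_config M B t c" "describes M B a t c" and "t \<le> B"
  shows "step_formula M B t a \<longleftrightarrow>
    (\<exists>c'. (ntm_step M c c' \<or> c' = c) \<and> describes M B a (Suc t) c')"
proof -
  obtain q tp h where [simp]: "c = (q, tp, h)" by (cases c)
  have h: "h \<in> cells B" and q: "q \<in> states M" and tp: "tp h \<in> symbols M"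
    using assms by (auto simp: bounded_config_def cells_def)
  have mv: "move_formula M B t i (r, s, q', s', d) a \<longleftrightarrow>
      i = h \<and> r = q \<and> s = tp h \<and> describes M B a (Suc t) (q', tp(h := s'), h + d)"
    if "i \<in> cells B" "(r, s, q', s', d) \<in> moves M" for i r s q' s' d
  proof -
    have read: "a (Hd t i) \<and> a (St t r) \<and> a (Sy t i s) \<longleftrightarrow> i = h \<and> r = q \<and> s = tp h"
      using c(2) that moves_cases[OF that(2)] q h tp by (auto simp: describes_def)
    have tape: "(\<forall>j \<in> cells B. \<forall>r \<in> symbols M.
          a (Sy (Suc t) j r) = (if j = h then s' = r else a (Sy t j r))) \<longleftrightarrow>
        (\<forall>j \<in> cells B. \<forall>r \<in> symbols M. a (Sy (Suc t) j r) = ((tp(h := s')) j = r))"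
      using c(2) by (intro ball_cong refl) (auto simp: describes_def)
    show ?thesis
    proof (cases "i = h \<and> r = q \<and> s = tp h")
      case True
      then show ?thesis
        using read tape by (simp only: move_formula_def describes_def prod.case fst_conv snd_conv simp_thms)
    next
      case False
      then show ?thesis using read by (simp only: move_formula_def prod.case) blast
    qed
  qed
  have "step_formula M B t a \<longleftrightarrow> (\<exists>q' s' d. (q, tp h, q', s', d) \<in> moves M \<and>
      describes M B a (Suc t) (q', tp(h := s'), h + d))"
  proof
    assume "step_formula M B t a"
    then obtain i r s q' s' d where "i \<in> cells B" "(r, s, q', s', d) \<in> moves M"
      "move_formula M B t i (r, s, q', s', d) a" by (auto simp: step_formula_def)
    then show "\<exists>q' s' d. (q, tp h, q', s', d) \<in> moves M \<and>
      describes M B a (Suc t) (q', tp(h := s'), h + d)" using mv by blast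
  next
    assume "\<exists>q' s' d. (q, tp h, q', s', d) \<in> moves M \<and>
      describes M B a (Suc t) (q', tp(h := s'), h + d)"
    then show "step_formula M B t a" unfolding step_formula_def using mv h by blast
  qed
  then show ?thesis
    unfolding \<open>c = (q, tp, h)\<close> step_or_idle_iff[OF c(1)[unfolded \<open>c = (q, tp, h)\<close>]] by blast
qed

text \<open>The assumed cell \<open>k\<close> without a bit ensures that the \<open>LEAST\<close> in
  \<open>tape_output\<close> is attained.\<close>

lemma tape_output_eq_iff:
  assumes "tp (int k) \<notin> {1, 2}"
  shows "tape_output (q, tp, h) = map f [0..<m] \<longleftrightarrow>
    (\<forall>i<m. tp (int i) \<in> {1, 2} \<and> (tp (int i) = 2) = f i) \<and> tp (int m) \<notin> {1, 2}" (is "?l \<longleftrightarrow> ?r")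
proof
  assume l: ?l
  then have m: "(LEAST k. tp (int k) \<notin> {1, 2}) = m"
    by (auto simp: tape_output_def dest: arg_cong[of _ _ length])
  have "tp (int m) \<notin> {1, 2}"
    using LeastI[of "\<lambda>k. tp (int k) \<notin> {1, 2}", OF assms] unfolding m .
  moreover have "tp (int i) \<in> {1, 2}" if "i < m" for i
    using not_less_Least[of i "\<lambda>k. tp (int k) \<notin> {1, 2}"] that unfolding m by blast
  moreover have "(tp (int i) = 2) = f i" if "i < m" for i
    using l that unfolding tape_output_def prod.case m by (simp add: map_eq_conv)
  ultimately show ?r by blast
next
  assume r: ?r
  then have "(LEAST k. tp (int k) \<notin> {1, 2}) = m"
    by (intro Least_equality) (auto simp flip: not_less)
  with r show ?l by (simp add: tape_output_def)
qed

lemma final_formula_iff: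
  assumes c: "bounded_config M B t c" "describes M B a t c" and "t \<le> B" "m \<le> B"
  shows "final_formula M B t m f a \<longleftrightarrow>
    halted M c \<and> fst c = accept_st M \<and> tape_output c = map (\<lambda>i. f i a) [0..<m]"
proof -
  obtain q tp h where cd [simp]: "c = (q, tp, h)" by (cases c)
  have h: "h \<in> cells B" and q: "q \<in> states M" and tp: "tp h \<in> symbols M"
    using assms by (auto simp: bounded_config_def cells_def)
  have sy: "a (Sy t (int i) s) = (tp (int i) = s)" if "i \<le> m" "s \<in> symbols M" for i s
    using c(2) that \<open>m \<le> B\<close> by (auto simp: describes_def cells_def)
  \<comment> \<open>The first cell beyond the window is blank and bounds the output.\<close>
  have "tp (int (B + 1)) = 0"
    using c(1) by (auto simp: bounded_config_def cells_def)
  then have out: "tape_output c = map (\<lambda>i. f i a) [0..<m] \<longleftrightarrow>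
      (\<forall>i<m. tp (int i) \<in> {1, 2} \<and> (tp (int i) = 2) = f i a) \<and> tp (int m) \<notin> {1, 2}"
    unfolding cd by (intro tape_output_eq_iff[of _ "B + 1"]) simp
  also have "\<dots> \<longleftrightarrow> (\<forall>i \<in> {..<m}. (a (Sy t (int i) 2) = f i a) \<and> (a (Sy t (int i) 1) = (\<not> f i a))) \<and>
     \<not> a (Sy t (int m) 1) \<and> \<not> a (Sy t (int m) 2)"
    using sy by (auto simp: less_imp_le)
  finally have out: "tape_output c = map (\<lambda>i. f i a) [0..<m] \<longleftrightarrow>
     (\<forall>i \<in> {..<m}. (a (Sy t (int i) 2) = f i a) \<and> (a (Sy t (int i) 1) = (\<not> f i a))) \<and>
     \<not> a (Sy t (int m) 1) \<and> \<not> a (Sy t (int m) 2)" .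
  have "a (Hd t i) \<and> a (St t (fst mv)) \<and> a (Sy t i (fst (snd mv))) \<longleftrightarrow>
      i = h \<and> fst mv = q \<and> fst (snd mv) = tp h" if "i \<in> cells B" "mv \<in> delta M" for i mv
  proof -
    have "fst mv \<in> states M" "fst (snd mv) \<in> symbols M"
      using that(2) delta_statesD delta_symbolsD by (metis prod.collapse)+
    then show ?thesis using c(2) that(1) by (auto simp: describes_def)
  qed
  moreover have "halted M c \<longleftrightarrow> (\<forall>mv \<in> delta M. \<not> (fst mv = q \<and> fst (snd mv) = tp h))"
    by (auto simp: halted_def ntm_step_def)
  ultimately have "(\<forall>i \<in> cells B. \<forall>mv \<in> delta M.
      \<not> (a (Hd t i) \<and> a (St t (fst mv)) \<and> a (Sy t i (fst (snd mv))))) \<longleftrightarrow> halted M c"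
    using h by (simp cong: ball_cong) blast
  moreover have "a (St t (accept_st M)) \<longleftrightarrow> fst c = accept_st M"
    using c(2) by (auto simp: describes_def)
  ultimately show ?thesis unfolding final_formula_def out by blast
qed

text \<open>Idle rows contribute no machine step, hence a run of length \<open>k \<le> n\<close>
  rather than exactly \<open>n\<close>.\<close>

lemma run_of_tableau:
  assumes M: "wf_ntm M" and c0: "bounded_config M B 0 c0" "describes M B a 0 c0"
    and "n \<le> B" and step: "\<And>t. t < n \<Longrightarrow> step_formula M B t a"
  shows "\<exists>k \<le> n. \<exists>c. (ntm_step M ^^ k) c0 c \<and> bounded_config M B n c \<and> describes M B a n c"
  using assms(4,5)
proof (induction n)
  case 0
  then show ?case using c0 by (intro exI[of _ 0]) auto
next
  case (Suc n)
  then obtain k c where k: "k \<le> n" "(ntm_step M ^^ k) c0 c" "bounded_config M B n c" "describes M B a n c"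
    by auto
  then obtain c' where c': "ntm_step M c c' \<or> c' = c" "describes M B a (Suc n) c'"
    using step_formula_iff[of M B n c a] Suc.prems by auto
  from c'(1) show ?case
  proof
    assume "ntm_step M c c'"
    then have "(ntm_step M ^^ Suc k) c0 c'" "bounded_config M B (Suc n) c'"
      using k bounded_step[OF M k(3)] Suc.prems(1) by auto
    then show ?thesis using k(1) c'(2) by (intro exI[of _ "Suc k"]) blast
  next
    assume "c' = c"
    moreover have "k \<le> Suc n" using k(1) by simp
    ultimately show ?thesis using k(2) c'(2) bounded_Suc[OF k(3)] by blast
  qed
qed

text \<open>The rows follow the run and then repeat its last configuration. Input and seed variables
  are separate from the tableau, so their values can be prescribed.\<close>

lemma tableau_of_run:
  assumes M: "wf_ntm M" and c0: "bounded_config M B 0 c0"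
    and "n \<le> B" "k \<le> n" and run: "(ntm_step M ^^ k) c0 c"
  shows "\<exists>a. (\<forall>i. a (In i) = y i) \<and> (\<forall>i. a (Seed i) = u i) \<and> describes M B a 0 c0 \<and>
    (\<forall>t<n. step_formula M B t a) \<and> bounded_config M B n c \<and> describes M B a n c"
proof -
  obtain cs where cs: "cs 0 = c0" "cs k = c" "\<And>i. i < k \<Longrightarrow> ntm_step M (cs i) (cs (Suc i))"
    using run unfolding relpowp_fun_conv by blast
  \<comment> \<open>\<open>min t k\<close> freezes the run at its end.\<close>
  define r where "r t = cs (min t k)" for t
  have r: "ntm_step M (r t) (r (Suc t)) \<or> r (Suc t) = r t" for t
    using cs(3)[of t] by (cases "t < k") (auto simp: r_def min_def)
  have bd: "bounded_config M B t (r t)" if "t \<le> B" for t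
    using that
  proof (induction t)
    case 0
    then show ?case using c0 cs by (simp add: r_def)
  next
    case (Suc t)
    then have "bounded_config M B t (r t)" "t < B" by auto
    then show ?case using r[of t] bounded_step[OF M] bounded_Suc by metis
  qed
  define a where "a v = (case v of In i \<Rightarrow> y i | Seed i \<Rightarrow> u i | St t q \<Rightarrow> q = fst (r t)
    | Hd t j \<Rightarrow> j = snd (snd (r t)) | Sy t j s \<Rightarrow> fst (snd (r t)) j = s)" for v
  have a: "describes M B a t (r t)" for t
    by (simp add: describes_def a_def)
  have "step_formula M B t a" if "t < n" for t
  proof -
    have "t \<le> B" using that \<open>n \<le> B\<close> by simp
    then show ?thesis using step_formula_iff[OF bd a] r[of t] a[of "Suc t"] by blast
  qed
  moreover have "r 0 = c0" "r n = c" using cs \<open>k \<le> n\<close> by (auto simp: r_def min_def)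
  ultimately show ?thesis
    using a[of 0] a[of n] bd[of n] \<open>n \<le> B\<close> by (intro exI[of _ a] conjI) (auto simp: a_def)
qed

text \<open>The same \<open>Seed\<close> variables fill the code on the initial tape and the matrix
  that hashes \<open>y\<close>, which ties the output of \<open>M\<close> to the right hash
  function.\<close>

definition guess_formula ::
  "ntm \<Rightarrow> nat \<Rightarrow> nat \<Rightarrow> nat \<Rightarrow> nat \<Rightarrow> (bool + nat) list \<Rightarrow> (var \<Rightarrow> bool) \<Rightarrow> bool" where
  "guess_formula M B T N m ls a \<longleftrightarrow>
     describes M B a 0 (init_config M (map (lit_val (\<lambda>k. a (Seed k))) ls)) \<and>
     (\<forall>t \<in> {..<T}. step_formula M B t a) \<and>
     final_formula M B T m (\<lambda>i a. parity_upto (\<lambda>j. a (Seed (i * N + j)) \<and> a (In j)) N) a"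

text \<open>An assignment amounts to a seed and a padded run. The condition on \<open>ls\<close>
  ensures that the tape reads only seed variables below \<open>m * N\<close>, so the seed can be cut
  out as a finite string.\<close>

lemma guess_formula_iff:
  assumes M: "wf_ntm M" and B: "T \<le> B" "m \<le> B" "length ls \<le> B"
    and ls: "Inr ` {m * N..} \<inter> set ls = {}"
  shows "(\<exists>a. (\<forall>i<N. a (In i) = y ! i) \<and> guess_formula M B T N m ls a) \<longleftrightarrow>
    (\<exists>u \<in> bitstrings (m * N). \<exists>k \<le> T. \<exists>c.
      accepting_run M (map (lit_val ((!) u)) ls) k c \<and> tape_output c = linear_hash N m u y)"
    (is "?l \<longleftrightarrow> ?r")
proof -
  have hash: "map (\<lambda>i. parity_upto (\<lambda>j. a (Seed (i * N + j)) \<and> a (In j)) N) [0..<m] = linear_hash N m u y"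
    if "\<forall>i<N. a (In i) = y ! i" "\<forall>l < m * N. a (Seed l) = u ! l" for a u
    using that matrix_index_less by (auto simp: linear_hash_def intro!: parity_upto_cong)
  have lits: "map (lit_val (\<lambda>l. a (Seed l))) ls = map (lit_val ((!) u)) ls"
    if "\<forall>l < m * N. a (Seed l) = u ! l" for a u
  proof (intro map_cong refl)
    fix x assume "x \<in> set ls"
    then have "k < m * N" if "x = Inr k" for k
      using ls that by (metis atLeast_iff disjoint_iff imageI not_le)
    then show "lit_val (\<lambda>l. a (Seed l)) x = lit_val ((!) u) x"
      using that by (auto simp: lit_val_def split: sum.split)
  qed
  show ?thesis
  proof
    assume ?l
    then obtain a where a: "\<forall>i<N. a (In i) = y ! i" "guess_formula M B T N m ls a" by blast
    define u where "u = map (\<lambda>l. a (Seed l)) [0..<m * N]"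
    have u: "\<forall>l < m * N. a (Seed l) = u ! l" by (simp add: u_def)
    let ?c0 = "init_config M (map (lit_val ((!) u)) ls)"
    obtain k c where k: "k \<le> T" "(ntm_step M ^^ k) ?c0 c" "bounded_config M B T c" "describes M B a T c"
      using run_of_tableau[OF M bounded_init _ B(1), of "map (lit_val ((!) u)) ls" a] a(2) B lits[OF u]
      by (auto simp: guess_formula_def)
    then have "accepting_run M (map (lit_val ((!) u)) ls) k c \<and> tape_output c = linear_hash N m u y"
      using final_formula_iff[OF k(3,4) B(1,2)] a(2) hash[OF a(1) u]
      by (auto simp: guess_formula_def accepting_run_def)
    moreover have "u \<in> bitstrings (m * N)" by (simp add: u_def bitstrings_def)
    ultimately show ?r using k(1) by blast
  next
    assume ?r
    then obtain u k c where u: "k \<le> T" "accepting_run M (map (lit_val ((!) u)) ls) k c"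
      "tape_output c = linear_hash N m u y" by blast
    let ?c0 = "init_config M (map (lit_val ((!) u)) ls)"
    obtain a where a: "\<forall>i. a (In i) = y ! i" "\<forall>i. a (Seed i) = u ! i" "describes M B a 0 ?c0"
      "\<forall>t<T. step_formula M B t a" "bounded_config M B T c" "describes M B a T c"
      using tableau_of_run[OF M bounded_init B(1) u(1), of "map (lit_val ((!) u)) ls" c "(!) y" "(!) u"]
        u(2) B(3) by (auto simp: accepting_run_def)
    then show ?l
      using final_formula_iff[OF a(5,6) B(1,2)] u hash[of a u] lits[of a u]
      by (intro exI[of _ a]) (auto simp: guess_formula_def accepting_run_def)
  qed
qed

section \<open>Size of the tableau formula\<close>

lemma expressible_if:
  "expressible P s \<Longrightarrow> expressible Q s \<Longrightarrow> expressible (\<lambda>a. if b then P a else Q a) s"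
  by (cases b) auto

text \<open>An input cell holds a fixed bit or a seed bit: testing it for symbol 2 is the seed
  variable, for symbol 1 its negation, and any other test fails.\<close>

lemma expressible_init_symbol:
  "expressible (\<lambda>a. fst (snd (init_config M (map (lit_val (\<lambda>k. a (Seed k))) ls))) j = s) 2"
proof -
  have const: "expressible (\<lambda>a. b) 2" for b
    by (rule expressible_mono[OF expressible_const]) simp
  have bit: "expressible (\<lambda>a. sym_of_bit (a v) = s) 2" for v :: var
  proof -
    consider "s = 1" | "s = 2" | "s \<noteq> 1" "s \<noteq> 2" by blast
    then show ?thesis
    proof cases
      case 1
      then show ?thesis
        using expressible_not[OF expressible_var[of v]] by (simp add: sym_of_bit_def numeral_2_eq_2)
    next
      case 2
      then show ?thesis
        using expressible_mono[OF expressible_var[of v], of 2] by (simp add: sym_of_bit_def)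
    next
      case 3
      then have "sym_of_bit b \<noteq> s" for b by (auto simp: sym_of_bit_def)
      then show ?thesis using const[of False] by simp
    qed
  qed
  show ?thesis
  proof (cases "0 \<le> j \<and> nat j < length ls")
    case False
    then have "fst (snd (init_config M (map f ls))) j = 0" for f
      by (auto simp: init_config_def)
    then show ?thesis using const[of "0 = s"] by simp
  next
    case True
    then have "fst (snd (init_config M (map f ls))) j = sym_of_bit (f (ls ! nat j))" for f
      by (simp add: init_config_def)
    then show ?thesis
      using bit const by (cases "ls ! nat j") (simp_all add: lit_val_def)
  qed
qed

lemma card_cells: "card (cells B) \<le> 2 * B + 1"
  by (simp add: cells_def)

lemma finite_cells: "finite (cells B)"
  by (simp add: cells_def)

text \<open>This and the following size functions are left unsimplified: they repeat the bounds of
  the \<open>expressible\<close> rules connective by connective, so that applying the rules matches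
  them by unification. \<open>K\<close> bounds the sets of the machine and \<open>b\<close> the
  number of cells.\<close>

definition init_size :: "nat \<Rightarrow> nat \<Rightarrow> nat" where
  "init_size K b = (K * ((1 + 1 + 2) + 1) + 1) + ((b * ((1 + 1 + 2) + 1) + 1) +
     (b * ((K * ((1 + 2 + 2) + 1) + 1) + 1) + 1) + 1) + 1"

definition move_size :: "nat \<Rightarrow> nat \<Rightarrow> nat" where
  "move_size K b = 1 + (1 + (1 + ((K * ((1 + 1 + 2) + 1) + 1) + ((b * ((1 + 1 + 2) + 1) + 1) +
     (b * ((K * ((1 + 1 + 2) + 1) + 1) + 1) + 1) + 1) + 1) + 1) + 1) + 1"

definition step_size :: "nat \<Rightarrow> nat \<Rightarrow> nat" where
  "step_size K b = b * ((K * (move_size K b + 2) + 2) + 2) + 2"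

definition final_size :: "nat \<Rightarrow> nat \<Rightarrow> nat \<Rightarrow> nat \<Rightarrow> nat" where
  "final_size K b m s = 1 + ((b * ((K * (((1 + (1 + 1 + 1) + 1) + 1) + 1) + 1) + 1) + 1) +
     ((m * (((1 + s + 2) + (1 + (s + 1) + 2) + 1) + 1) + 1) + ((1 + 1) + (1 + 1) + 1) + 1) + 1) + 1"

definition guess_size :: "nat \<Rightarrow> nat \<Rightarrow> nat \<Rightarrow> nat \<Rightarrow> nat \<Rightarrow> nat" where
  "guess_size K b T N m = init_size K b + ((T * (step_size K b + 1) + 1) +
     final_size K b m (N * ((1 + 1 + 1) + 1) + 1) + 1) + 1"

definition machine_size :: "ntm \<Rightarrow> nat" where
  "machine_size M = card (states M) + card (symbols M) + card (moves M)"

lemma card_machine_parts: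
  assumes "wf_ntm M"
  shows "card (states M) \<le> machine_size M" "card (symbols M) \<le> machine_size M"
    "card (moves M) \<le> machine_size M" "card (delta M) \<le> machine_size M"
proof -
  have "card (delta M) \<le> card (moves M)"
    using finite_machine[OF assms] by (intro card_mono) (auto simp: moves_def)
  then show "card (delta M) \<le> machine_size M" by (simp add: machine_size_def)
qed (auto simp: machine_size_def)

lemma fst_snd_init_config [simp]:
  "fst (init_config M x) = start_st M" "snd (snd (init_config M x)) = 0"
  by (simp_all add: init_config_def)

lemma finite_delta: "wf_ntm M \<Longrightarrow> finite (delta M)"
  by (simp add: wf_ntm_def)

lemma expressible_init:
  assumes "wf_ntm M"
  shows "expressible (\<lambda>a. describes M B a 0 (init_config M (map (lit_val (\<lambda>k. a (Seed k))) ls)))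
    (init_size (machine_size M) (2 * B + 1))"
  unfolding describes_def init_size_def fst_snd_init_config
  by (intro expressible_and expressible_Ball expressible_eq expressible_var expressible_const
      expressible_init_symbol finite_machine card_machine_parts assms finite_cells card_cells)

lemma expressible_step:
  assumes "wf_ntm M"
  shows "expressible (step_formula M B t) (step_size (machine_size M) (2 * B + 1))"
proof -
  have "expressible (\<lambda>a. move_formula M B t i mv a) (move_size (machine_size M) (2 * B + 1))" for i mv
    unfolding move_formula_def move_size_def case_prod_beta
    by (intro expressible_and expressible_Ball expressible_eq expressible_if[where s = 1] expressible_const
        expressible_var finite_machine card_machine_parts assms finite_cells card_cells)
  then show ?thesis
    unfolding step_formula_def[abs_def] step_size_def
    by (intro expressible_Bex finite_machine card_machine_parts assms finite_cells card_cells)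
qed

lemma expressible_final:
  assumes "wf_ntm M" "\<And>i. i < m \<Longrightarrow> expressible (f i) s"
  shows "expressible (final_formula M B t m f) (final_size (machine_size M) (2 * B + 1) m s)"
  unfolding final_formula_def[abs_def] final_size_def
  by (intro expressible_and expressible_Ball expressible_eq expressible_not expressible_var
      assms finite_delta card_machine_parts finite_cells card_cells) auto

lemma expressible_guess:
  assumes "wf_ntm M"
  shows "expressible (guess_formula M B T N m ls) (guess_size (machine_size M) (2 * B + 1) T N m)"
  unfolding guess_formula_def[abs_def] guess_size_def
  by (intro expressible_and expressible_Ball expressible_init expressible_step expressible_final
      expressible_parity_upto expressible_var assms) auto

section \<open>Polynomial bounds\<close>

lemma poly_bounded_const: "poly_bounded (\<lambda>n. c)"
  unfolding poly_bounded_def by (intro exI[of _ c]) simp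

lemma poly_bounded_ident: "poly_bounded (\<lambda>n. n)"
  unfolding poly_bounded_def by (intro exI[of _ 1]) simp

text \<open>The summand 1 covers \<open>n = 0\<close> and \<open>k = 0\<close>, where the left side
  is 1 but the power on the right may be 0.\<close>

lemma power_le_Suc_power:
  fixes n :: nat
  assumes "k \<le> l"
  shows "n ^ k \<le> n ^ l + 1"
proof (cases "n = 0")
  case False
  then have "n ^ k \<le> n ^ l" using assms by (intro power_increasing) auto
  then show ?thesis by simp
qed (simp add: power_0_left)

lemma poly_bounded_add:
  assumes "poly_bounded f" "poly_bounded g"
  shows "poly_bounded (\<lambda>n. f n + g n)"
proof -
  obtain c k d l where f: "\<And>n. f n \<le> c * n ^ k + c" and g: "\<And>n. g n \<le> d * n ^ l + d"
    using assms unfolding poly_bounded_def by blast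
  have "f n + g n \<le> (2 * c + 2 * d) * n ^ (k + l) + (2 * c + 2 * d)" for n
  proof -
    have "f n + g n \<le> c * (n ^ (k + l) + 1) + c + (d * (n ^ (k + l) + 1) + d)"
      using f[of n] g[of n] power_le_Suc_power[of k "k + l" n] power_le_Suc_power[of l "k + l" n]
      by (meson add_mono le_add1 le_add2 le_refl mult_le_mono order_trans)
    also have "\<dots> \<le> (2 * c + 2 * d) * n ^ (k + l) + (2 * c + 2 * d)"
      by (simp add: algebra_simps)
    finally show ?thesis .
  qed
  then show ?thesis unfolding poly_bounded_def by blast
qed

lemma poly_bounded_mult:
  assumes "poly_bounded f" "poly_bounded g"
  shows "poly_bounded (\<lambda>n. f n * g n)"
proof -
  obtain c k d l where f: "\<And>n. f n \<le> c * n ^ k + c" and g: "\<And>n. g n \<le> d * n ^ l + d"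
    using assms unfolding poly_bounded_def by blast
  have "f n * g n \<le> (3 * c * d) * n ^ (k + l) + 3 * c * d" for n
  proof -
    have "f n * g n \<le> (c * n ^ k + c) * (d * n ^ l + d)"
      using f g by (intro mult_le_mono)
    also have "\<dots> = c * d * (n ^ (k + l) + n ^ k + n ^ l + 1)"
      by (simp add: algebra_simps power_add)
    also have "\<dots> \<le> c * d * (n ^ (k + l) + (n ^ (k + l) + 1) + (n ^ (k + l) + 1) + 1)"
      using power_le_Suc_power[of k "k + l" n] power_le_Suc_power[of l "k + l" n]
      by (intro mult_le_mono2 add_mono) auto
    also have "\<dots> = (3 * c * d) * n ^ (k + l) + 3 * c * d"
      by (simp add: algebra_simps)
    finally show ?thesis .
  qed
  then show ?thesis unfolding poly_bounded_def by blast
qed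

lemma poly_bounded_power: "poly_bounded f \<Longrightarrow> poly_bounded (\<lambda>n. f n ^ k)"
  by (induction k) (auto intro: poly_bounded_const poly_bounded_mult)

lemma poly_bounded_Suc: "poly_bounded f \<Longrightarrow> poly_bounded (\<lambda>n. Suc (f n))"
  using poly_bounded_add[OF _ poly_bounded_const[of 1]] by simp

lemma poly_bounded_mono: "poly_bounded f \<Longrightarrow> (\<And>n. g n \<le> f n) \<Longrightarrow> poly_bounded g"
  unfolding poly_bounded_def by (meson order_trans)

lemmas poly_bounded_intros = poly_bounded_const poly_bounded_ident poly_bounded_add
  poly_bounded_mult poly_bounded_power poly_bounded_Suc

lemma poly_bounded_guess_size:
  assumes "poly_bounded b" "poly_bounded T" "poly_bounded N" "poly_bounded m"
  shows "poly_bounded (\<lambda>n. guess_size K (b n) (T n) (N n) (m n))"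
  unfolding guess_size_def init_size_def step_size_def move_size_def final_size_def
  by (intro poly_bounded_intros assms)

section \<open>Avoid and demi-bits\<close>

text \<open>A formula may mention variables on which \<open>P\<close> does not depend; all of them
  are redirected to \<open>v\<close>. This is needed to compile it, as gates may read only existing
  wires.\<close>

lemma expressible_on:
  assumes "expressible P s" and V: "v \<in> V"
    and P: "\<And>a b. (\<And>w. w \<in> V \<Longrightarrow> a w = b w) \<Longrightarrow> P a = P b"
  shows "\<exists>p. set_fm p \<subseteq> V \<and> (\<forall>a. fm_eval a p = P a) \<and> fm_size p \<le> s"
proof -
  obtain p where p: "\<And>a. fm_eval a p = P a" "fm_size p \<le> s"
    using assms(1) by (auto simp: expressible_def)
  let ?p = "map_fm (\<lambda>w. if w \<in> V then w else v) p"
  have "fm_eval a ?p = P a" for a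
    unfolding fm_eval_map p(1) by (rule P) simp
  moreover have "set_fm ?p \<subseteq> V" using V by (auto simp: fm.set_map)
  ultimately show ?thesis using p(2) by (intro exI[of _ ?p]) simp
qed

text \<open>The hash is computed from the seed wires and the output wires of \<open>C\<close>, so
  \<open>hs\<close> and \<open>rs\<close> are the same for every seed. This is what makes a common
  code template possible.\<close>

lemma hash_circuit_exists:
  assumes C: "computes C n N g"
  shows "\<exists>hs rs. length rs = m \<and> length hs \<le> m * (4 * (N * ((1 + 1 + 1) + 1) + 1)) \<and>
    (\<forall>u \<in> bitstrings (m * N). wf_circuit (seeded_circuit n (gates C) hs rs u) \<and>
      (\<forall>x \<in> bitstrings n. eval_circuit (seeded_circuit n (gates C) hs rs u) x = linear_hash N m u (g x)))"
proof -
  let ?gs = "gates C" and ?os = "outputs C"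
  let ?w = "n + length ?gs"
  let ?k = "?w + 2 + m * N"
  let ?s = "N * ((1 + 1 + 1) + 1) + 1"
  \<comment> \<open>Hash bit \<open>i\<close> in terms of wires; the offset 2 skips the two constant
    wires before the seed.\<close>
  define P where "P i a = parity_upto (\<lambda>j. a (?w + 2 + (i * N + j)) \<and> a (?os ! j)) N"
    for i and a :: "nat \<Rightarrow> bool"
  have C': "wf_gates n ?gs" "length ?os = N" "\<And>j. j < N \<Longrightarrow> ?os ! j < ?w" "ninputs C = n"
    using C by (auto simp: computes_def wf_circuit_iff)
  have "\<exists>p. set_fm p \<subseteq> {..<?k} \<and> (\<forall>a. fm_eval a p = P i a) \<and> fm_size p \<le> ?s" if "i < m" for i
  proof (rule expressible_on[of _ _ 0])
    show "expressible (P i) ?s"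
      unfolding P_def[abs_def] by (intro expressible_parity_upto expressible_and expressible_var)
    show "P i a = P i b" if ab: "\<And>w. w \<in> {..<?k} \<Longrightarrow> a w = b w" for a b
      unfolding P_def
    proof (rule parity_upto_cong)
      fix j assume j: "j < N"
      have "?w + 2 + (i * N + j) < ?k" "?os ! j < ?k"
        using matrix_index_less[OF \<open>i < m\<close> j] C'(3)[OF j] by auto
      then show "(a (?w + 2 + (i * N + j)) \<and> a (?os ! j)) = (b (?w + 2 + (i * N + j)) \<and> b (?os ! j))"
        using ab by simp
    qed
  qed auto
  then obtain p where p: "\<And>i. i < m \<Longrightarrow> set_fm (p i) \<subseteq> {..<?k}"
    "\<And>i a. i < m \<Longrightarrow> fm_eval a (p i) = P i a" "\<And>i. i < m \<Longrightarrow> fm_size (p i) \<le> ?s"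
    by metis
  have "set_fm q \<subseteq> {..<?k}" if q: "q \<in> set (map p [0..<m])" for q
  proof -
    obtain i where "i < m" "q = p i" using q by auto
    then show ?thesis using p(1) by blast
  qed
  from gates_compute_list_exists[OF this]
  obtain hs rs where hs: "wf_gates ?k hs" "length hs \<le> (\<Sum>q\<leftarrow>map p [0..<m]. 4 * fm_size q)"
    "length rs = length (map p [0..<m])" "\<And>r. r \<in> set rs \<Longrightarrow> r < ?k + length hs"
    "\<And>vs. length vs = ?k \<Longrightarrow>
      map ((!) (eval_gates vs hs)) rs = map (fm_eval ((!) vs)) (map p [0..<m])"
    by blast
  note hs(2)
  also have "(\<Sum>q\<leftarrow>map p [0..<m]. 4 * fm_size q) \<le> (\<Sum>q\<leftarrow>map p [0..<m]. 4 * ?s)"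
  proof (intro sum_list_mono mult_le_mono2)
    fix q assume "q \<in> set (map p [0..<m])"
    then obtain i where "i < m" "q = p i" by auto
    then show "fm_size q \<le> ?s" using p(3) by blast
  qed
  also have "\<dots> = m * (4 * ?s)" by (simp only: map_replicate_const sum_list_replicate) simp
  finally have len: "length hs \<le> m * (4 * ?s)" .
  have "wf_circuit (seeded_circuit n ?gs hs rs u) \<and>
      (\<forall>x \<in> bitstrings n. eval_circuit (seeded_circuit n ?gs hs rs u) x = linear_hash N m u (g x))"
    if u: "u \<in> bitstrings (m * N)" for u
  proof (intro conjI ballI)
    have ul: "length u = m * N" using u by (simp add: bitstrings_def)
    show "wf_circuit (seeded_circuit n ?gs hs rs u)"
      using C'(1) hs(1,4) ul by (intro wf_seeded_circuit) auto
    fix x assume "x \<in> bitstrings n"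
    then have x: "length x = n" "eval_circuit C x = g x" using C by (auto simp: computes_def bitstrings_def)
    let ?vs = "eval_gates x ?gs @ [False, True] @ u"
    have vs: "length ?vs = ?k" using x ul by simp
    have "eval_circuit (seeded_circuit n ?gs hs rs u) x = map (\<lambda>i. fm_eval ((!) ?vs) (p i)) [0..<m]"
      unfolding eval_seeded_circuit[OF x(1)] hs(5)[OF vs] by (simp add: comp_def)
    also have "\<dots> = linear_hash N m u (g x)"
      unfolding linear_hash_def
    proof (rule map_cong[OF refl])
      fix i assume "i \<in> set [0..<m]"
      then have i: "i < m" by simp
      show "fm_eval ((!) ?vs) (p i) = parity_upto (\<lambda>j. u ! (i * N + j) \<and> g x ! j) N"
        unfolding p(2)[OF i] P_def
      proof (rule parity_upto_cong)
        fix j assume j: "j < N"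
        have "?vs ! (?w + 2 + (i * N + j)) = u ! (i * N + j)"
          using x(1) by (simp add: nth_append)
        moreover have "?vs ! (?os ! j) = eval_circuit C x ! j"
          using C'(2) C'(3)[OF j] j x(1) by (simp add: nth_append eval_circuit_def)
        ultimately show "(?vs ! (?w + 2 + (i * N + j)) \<and> ?vs ! (?os ! j)) = (u ! (i * N + j) \<and> g x ! j)"
          using x(2) by simp
      qed
    qed
    finally show "eval_circuit (seeded_circuit n ?gs hs rs u) x = linear_hash N m u (g x)" .
  qed
  then show ?thesis using hs(3) len by (intro exI[of _ hs] exI[of _ rs]) auto
qed

lemma Avoid_enc_circuit_iff:
  "Avoid (enc_circuit C) y \<longleftrightarrow> wf_circuit C \<and> ninputs C < length (outputs C) \<and>
     y \<in> bitstrings (length (outputs C)) \<and> y \<notin> eval_circuit C ` bitstrings (ninputs C)"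
  unfolding Avoid_def using inj_enc_circuit by blast

lemma Avoid_solvable:
  assumes "wf_circuit C" "ninputs C < length (outputs C)"
  shows "\<exists>y. Avoid (enc_circuit C) y"
proof -
  have "card (eval_circuit C ` bitstrings (ninputs C)) \<le> 2 ^ ninputs C"
    using card_image_le[of "bitstrings (ninputs C)" "eval_circuit C"] by simp
  also have "\<dots> < 2 ^ length (outputs C)" using assms(2) by (simp add: power_strict_increasing)
  finally have "\<not> bitstrings (length (outputs C)) \<subseteq> eval_circuit C ` bitstrings (ninputs C)"
    using card_mono[of "eval_circuit C ` bitstrings (ninputs C)" "bitstrings (length (outputs C))"] by auto
  then show ?thesis using assms by (auto simp: Avoid_enc_circuit_iff)
qed

lemma solves_searchD:
  assumes "solves_search M R" "accepting_run M x k c"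
  shows "R x (tape_output c)"
  using assms unfolding solves_search_def by blast

lemma solves_search_exists:
  assumes "solves_search M R" "R x y"
  shows "\<exists>k c. accepting_run M x k c"
  using assms unfolding solves_search_def by blast

text \<open>Size bound for the seeded circuit: \<open>C\<close>, two constants, the seed, the hash
  gates and the \<open>m\<close> outputs.\<close>

definition hash_avoid_size :: "nat \<Rightarrow> nat \<Rightarrow> nat \<Rightarrow> nat" where
  "hash_avoid_size s N m = s + 2 + m * N + m * (4 * (N * ((1 + 1 + 1) + 1) + 1)) + m"

definition code_length :: "nat \<Rightarrow> nat" where
  "code_length s = 6 * s * s + 20 * s + 6"

text \<open>The whole argument at a single length \<open>n\<close>. The size bound stays explicit,
  so that its polynomial growth in \<open>n\<close> can be checked afterwards; \<open>n < m\<close>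
  makes the seeded circuits instances that have a solution.\<close>

lemma refuter_circuit:
  fixes m N :: nat
  assumes M: "wf_ntm M" "solves_search M Avoid"
    and time: "\<And>x k c. (ntm_step M ^^ k) (init_config M x) c \<Longrightarrow> k \<le> e * length x ^ d + e"
    and C: "computes C n N g" and m: "n < m"
  defines "L \<equiv> code_length (hash_avoid_size (circuit_size C) N m)"
  shows "\<exists>D. nd_circuit D N \<and>
    circuit_size D \<le> N + 5 * guess_size (machine_size M) (2 * (e * L ^ d + e + L + m) + 1) (e * L ^ d + e) N m + 1 \<and>
    (\<forall>x \<in> bitstrings n. \<not> nd_eval D N (g x)) \<and>
    card {y \<in> bitstrings N. \<not> nd_eval D N y} \<le> 2 ^ m * 2 ^ m"
proof -
  obtain hs rs where rs: "length rs = m" and hs: "length hs \<le> m * (4 * (N * ((1 + 1 + 1) + 1) + 1))"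
    and wf: "\<And>u. u \<in> bitstrings (m * N) \<Longrightarrow> wf_circuit (seeded_circuit n (gates C) hs rs u)"
    and ev: "\<And>u x. u \<in> bitstrings (m * N) \<Longrightarrow> x \<in> bitstrings n \<Longrightarrow>
      eval_circuit (seeded_circuit n (gates C) hs rs u) x = linear_hash N m u (g x)"
    using hash_circuit_exists[OF C, of m] by blast
  let ?S = "seeded_circuit n (gates C) hs rs"
  have io [simp]: "ninputs (?S u) = n" "length (outputs (?S u)) = m" for u
    using rs by (simp_all add: seeded_circuit_def)
  obtain ls where ls: "Inr ` {m * N..} \<inter> set ls = {}"
    "\<And>u. length u = m * N \<Longrightarrow> enc_circuit (?S u) = map (lit_val ((!) u)) ls"
    using enc_seeded_circuit_lits by metis
  have enc: "map (lit_val ((!) u)) ls = enc_circuit (?S u)" if "u \<in> bitstrings (m * N)" for u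
    using ls(2) that by (simp add: bitstrings_def)
  have "length ls \<le> L"
  proof -
    \<comment> \<open>Any seed would do, since all codes have the length of the template.\<close>
    let ?u = "replicate (m * N) False"
    have u: "?u \<in> bitstrings (m * N)" by (simp add: bitstrings_def)
    have "circuit_size (?S ?u) \<le> hash_avoid_size (circuit_size C) N m"
      using hs rs C by (simp add: seeded_circuit_def circuit_size_def hash_avoid_size_def computes_def)
    then have "length (enc_circuit (?S ?u)) \<le> L"
      unfolding L_def code_length_def by (rule length_enc_circuit[OF wf[OF u]])
    then show ?thesis using enc[OF u] by (metis length_map)
  qed
  \<comment> \<open>\<open>?T\<close> bounds the running time on codes of length at most
    \<open>L\<close>; \<open>?B\<close> dominates the running time, the code length and the output
    length at once.\<close>
  let ?T = "e * L ^ d + e" let ?B = "?T + L + m"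
  have run_time: "k \<le> ?T" if "accepting_run M (enc_circuit (?S u)) k c" "u \<in> bitstrings (m * N)" for u k c
  proof -
    have "k \<le> e * length ls ^ d + e"
      using that(1) time[of k "enc_circuit (?S u)" c] unfolding enc[OF that(2), symmetric]
      by (simp add: accepting_run_def)
    also have "\<dots> \<le> ?T" using \<open>length ls \<le> L\<close> by (simp add: power_mono)
    finally show ?thesis .
  qed
  obtain D where D: "nd_circuit D N"
    "circuit_size D \<le> N + 5 * guess_size (machine_size M) (2 * ?B + 1) ?T N m + 1"
    "\<And>y. y \<in> bitstrings N \<Longrightarrow> nd_eval D N y \<longleftrightarrow>
      (\<exists>a. (\<forall>i<N. a (In i) = y ! i) \<and> guess_formula M ?B ?T N m ls a)"
    using nd_circuit_of_expressible[OF expressible_guess[OF M(1)], of In N ?B ?T N m ls]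
    by (auto simp: inj_def)
  have nd: "nd_eval D N y \<longleftrightarrow> (\<exists>u \<in> bitstrings (m * N). \<exists>k c.
      accepting_run M (enc_circuit (?S u)) k c \<and> tape_output c = linear_hash N m u y)"
    if y: "y \<in> bitstrings N" for y
  proof -
    have "nd_eval D N y \<longleftrightarrow> (\<exists>u \<in> bitstrings (m * N). \<exists>k \<le> ?T. \<exists>c.
      accepting_run M (map (lit_val ((!) u)) ls) k c \<and> tape_output c = linear_hash N m u y)"
      unfolding D(3)[OF y] using \<open>length ls \<le> L\<close> ls(1) by (intro guess_formula_iff M) auto
    then show ?thesis using enc run_time by (metis (no_types, lifting))
  qed
  have avoid: "Avoid (enc_circuit (?S u)) (tape_output c)"
    if "accepting_run M (enc_circuit (?S u)) k c" for u k c
    using solves_searchD[OF M(2) that] .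
  have "\<not> nd_eval D N (g x)" if x: "x \<in> bitstrings n" for x
  proof
    assume nd_x: "nd_eval D N (g x)"
    have "g x \<in> bitstrings N"
    proof -
      have "g x = eval_circuit C x" "length (outputs C) = N" using C x by (auto simp: computes_def)
      then show ?thesis by (simp add: bitstrings_def eval_circuit_def Let_def)
    qed
    then obtain u k c where u: "u \<in> bitstrings (m * N)" "accepting_run M (enc_circuit (?S u)) k c"
      "tape_output c = linear_hash N m u (g x)" using nd nd_x by blast
    then have "linear_hash N m u (g x) \<notin> eval_circuit (?S u) ` bitstrings n"
      using avoid[OF u(2)] by (simp add: Avoid_enc_circuit_iff)
    \<comment> \<open>The seeded circuit maps \<open>x\<close> to the hash of \<open>g x\<close>,
      exactly the value that \<open>M\<close> claims to lie outside its range.\<close>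
    then show False using ev[OF u(1) x] x by (metis imageI)
  qed
  moreover have "card {y \<in> bitstrings N. \<not> nd_eval D N y} \<le> 2 ^ m * 2 ^ m"
  proof -
    \<comment> \<open>One accepting run per seed is enough: its output is the value that the hash of
      a rejected string must miss.\<close>
    have "\<exists>k c. accepting_run M (enc_circuit (?S u)) k c" if "u \<in> bitstrings (m * N)" for u
      using Avoid_solvable[of "?S u"] wf[OF that] m solves_search_exists[OF M(2)] by auto
    then obtain K F where F: "\<And>u. u \<in> bitstrings (m * N) \<Longrightarrow>
        accepting_run M (enc_circuit (?S u)) (K u) (F u)" by metis
    show ?thesis
    proof (rule linear_hash_avoid[of _ N m "\<lambda>u. tape_output (F u)"])
      show "tape_output (F u) \<in> bitstrings m" if "u \<in> bitstrings (m * N)" for u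
        using avoid[OF F[OF that]] by (simp add: Avoid_enc_circuit_iff)
      show "linear_hash N m u y \<noteq> tape_output (F u)"
        if "u \<in> bitstrings (m * N)" "y \<in> {y \<in> bitstrings N. \<not> nd_eval D N y}" for u y
      proof
        assume "linear_hash N m u y = tape_output (F u)"
        then have "nd_eval D N y" using nd[of y] F[OF that(1)] that by (metis (mono_tags) mem_Collect_eq)
        then show False using that(2) by blast
      qed
    qed auto
  qed
  ultimately show ?thesis using D(1,2) by blast
qed

theorem theorem1p1:
  assumes "\<exists>G. demibits_generator G (\<lambda>n. 10 * n)"
  shows "Avoid \<notin> SearchNP"
proof
  assume "Avoid \<in> SearchNP"
  then obtain M where M: "wf_ntm M" "ntm_poly_time M" "solves_search M Avoid"
    by (auto simp: SearchNP_def)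
  obtain e d where time: "\<And>x k c. (ntm_step M ^^ k) (init_config M x) c \<Longrightarrow> k \<le> e * length x ^ d + e"
    using M(2) unfolding ntm_poly_time_def by blast
  obtain G where G: "demibits_generator G (\<lambda>n. 10 * n)" using assms by blast
  then obtain C where C: "\<And>n. computes (C n) n (10 * n) (G n)"
    "poly_bounded (\<lambda>n. circuit_size (C n))"
    unfolding demibits_generator_def by blast
  \<comment> \<open>\<open>Suc n\<close> is the smallest hash length for which the seeded circuits
    have more outputs than inputs.\<close>
  define L where "L n = code_length (hash_avoid_size (circuit_size (C n)) (10 * n) (Suc n))" for n
  define T where "T n = e * L n ^ d + e" for n
  have "\<forall>n. \<exists>D. nd_circuit D (10 * n) \<and>
    circuit_size D \<le> 10 * n +
      5 * guess_size (machine_size M) (2 * (T n + L n + Suc n) + 1) (T n) (10 * n) (Suc n) + 1 \<and>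
    (\<forall>x \<in> bitstrings n. \<not> nd_eval D (10 * n) (G n x)) \<and>
    card {y \<in> bitstrings (10 * n). \<not> nd_eval D (10 * n) y} \<le> 2 ^ Suc n * 2 ^ Suc n"
    unfolding L_def T_def by (intro allI refuter_circuit[OF M(1,3) time C(1)]) auto
  from choice[OF this] obtain D where D: "\<And>n. nd_circuit (D n) (10 * n)"
    "\<And>n. circuit_size (D n) \<le> 10 * n +
      5 * guess_size (machine_size M) (2 * (T n + L n + Suc n) + 1) (T n) (10 * n) (Suc n) + 1"
    "\<And>n x. x \<in> bitstrings n \<Longrightarrow> \<not> nd_eval (D n) (10 * n) (G n x)"
    "\<And>n. card {y \<in> bitstrings (10 * n). \<not> nd_eval (D n) (10 * n) y} \<le> 2 ^ Suc n * 2 ^ Suc n"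
    by blast
  have L: "poly_bounded L"
    unfolding L_def[abs_def] code_length_def hash_avoid_size_def by (intro poly_bounded_intros C)
  then have T: "poly_bounded T"
    unfolding T_def[abs_def] by (intro poly_bounded_intros)
  have "poly_bounded (\<lambda>n. circuit_size (D n))"
    by (rule poly_bounded_mono[OF _ D(2)]) (intro poly_bounded_intros poly_bounded_guess_size L T)
  then have D_small: "(\<forall>n. nd_circuit (D n) (10 * n)) \<and> poly_bounded (\<lambda>n. circuit_size (D n))"
    using D(1) by blast
  have secure: "\<exists>n0. \<forall>n \<ge> n0.
      \<not> (real (card {y \<in> bitstrings (10 * n). nd_eval (D n) (10 * n) y}) / 2 ^ (10 * n) \<ge> 1 / 3 \<and>
         (\<forall>x \<in> bitstrings n. \<not> nd_eval (D n) (10 * n) (G n x)))"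
    by (rule mp[OF spec[OF conjunct2[OF conjunct2[OF G[unfolded demibits_generator_def]]]] D_small])
  then obtain n0 where n0: "\<And>n. n \<ge> n0 \<Longrightarrow>
      \<not> real (card {y \<in> bitstrings (10 * n). nd_eval (D n) (10 * n) y}) / 2 ^ (10 * n) \<ge> 1 / 3"
    using D(3) by blast
  \<comment> \<open>The successor makes \<open>n\<close> positive, as required for
    \<open>2 * n + 3 \<le> 10 * n\<close> below.\<close>
  define n where "n = Suc n0"
  let ?A = "{y \<in> bitstrings (10 * n). nd_eval (D n) (10 * n) y}"
  let ?R = "{y \<in> bitstrings (10 * n). \<not> nd_eval (D n) (10 * n) y}"
  have "card ?A + card ?R = card (?A \<union> ?R)"
    by (intro card_Un_disjoint[symmetric]) auto
  also have "?A \<union> ?R = bitstrings (10 * n)" by blast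
  finally have sum: "card ?A + card ?R = 2 ^ (10 * n)" by simp
  \<comment> \<open>At most half of all strings are rejected, so at least half are accepted, which
    exceeds the threshold \<open>1 / 3\<close>.\<close>
  have "2 * card ?R \<le> 2 * (2 ^ Suc n * 2 ^ Suc n)" using D(4)[of n] by simp
  also have "\<dots> = 2 ^ Suc (Suc n + Suc n)" by (simp only: power_add power_Suc)
  also have "\<dots> \<le> (2 :: nat) ^ (10 * n)" by (intro power_increasing) (auto simp: n_def)
  finally have "2 ^ (10 * n) \<le> 2 * card ?A" using sum by simp
  then have "real (2 ^ (10 * n)) \<le> real (2 * card ?A)" by (rule of_nat_mono)
  then have "real (card ?A) / 2 ^ (10 * n) \<ge> 1 / 3" by (simp add: field_simps)
  then show False using n0[of n] by (simp add: n_def)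
qed

end
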